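(* Let $P$ be a 3-colorable convex polytope with $2n$ vertices, with a fixed proper coloring of its faces by $1,2,3$, let $m_i$ be the number of faces colored by $i$, and let $\widetilde P$ be the convex hull of the face-vertex incident vectors of $P$, with vertex set $S=V_1\cup V_2\cup V_3$. Suppose $m_3>m_2>m_1\geq 2$. Then a Gale diagram of $\widetilde P$ lies in $\mathbb{R}$ and consists of the point $1$ with multiplicity $m_2$ and the point $-1$ with multiplicity $m_1+m_3$, where the vertices of $\widetilde P$ colored by $1$ or $3$ correspond to the point $-1$ and the vertices colored by $2$ correspond to the point $1$. Hence: (1) for $J\subseteq S$, $\operatorname{conv}(J)$ is a proper face of $\widetilde P$ if and only if $V_2\not\subseteq J$ and $V_1\cup V_3\not\subseteq J$; (2) $\widetilde P$ is a simplicial convex polytope. Furthermore, (3) $\widetilde P$ is combinatorially equivalent to $T^n_{m_2-1}=\operatorname{conv}(\{v\}\cup\Delta^n)$, where $\Delta^n$ is an $n$-simplex, $v\notin\Delta^n$, and $v$ is beyond $m_2-1$ facets of $\Delta^n$.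
   Context: A convex polytope $P$ is 3-colorable if it is 3-dimensional and simple (each vertex belongs to exactly three 2-dimensional faces) and each facet can be assigned a color in $\{1,2,3\}$ so that adjacent facets have different colors. "Face of $P$" means 2-dimensional face. Such a $P$ has an even number $2n$ of vertices and $n+2$ faces. Identify the vertex set of $P$ with $\{1,\dots,2n\}$. For a face $f$ of $P$, $\xi_f\in\{0,1\}^{2n}\subseteq\mathbb{R}^{2n}$ (the face-vertex incident vector) has entry $1$ at $v$ if $v\in f$ and $0$ otherwise. Let $S=\{\xi_f: f\text{ a face of }P\}$, $\widetilde P=\operatorname{conv}(S)$. The vertex set of $\widetilde P$ is exactly $S$, of size $n+2$. Put $V_i=\{\xi_f: f\text{ is colored by }i\}$; elements of $V_i$ are called vertices of $\widetilde P$ colored by $i$, and $|V_i|=m_i$. Gale transform/diagram: for a list $v_1,\dots,v_N$ of column vectors in a Euclidean space with $d=\dim\operatorname{conv}\{v_1,\dots,v_N\}$, choose a basis $\beta_1,\dots,\beta_{N-d-1}$ of the null space of the matrix $\begin{bmatrix}1&\cdots&1\\ v_1&\cdots&v_N\end{bmatrix}$ and let $\bar v_j\in\mathbb{R}^{N-d-1}$ be the $j$-th row of $[\beta_1,\dots,\beta_{N-d-1}]$. The multiset $\{\bar v_j\}$ is a Gale transform, $\bar v_j$ corresponding to $v_j$. Replacing each nonzero $\bar v_j$ by $\bar v_j/\|\bar v_j\|$ (and leaving zero vectors as $0$) gives a Gale diagram. A Gale diagram of a polytope is one of its vertex set. A proper face is a face different from the whole polytope (the empty face is allowed). A polytope is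 simplicial if all its proper faces are simplices. A point $v$ is beyond a facet $F$ of a full-dimensional polytope if the hyperplane spanned by $F$ strictly separates $v$ from the interior of the polytope; it is beneath $F$ if $v$ lies strictly on the same side as the interior. $T^n_k$ denotes the convex hull of an $n$-simplex $\Delta^n$ in $\mathbb{R}^n$ and a point that is beyond exactly $k$ facets of $\Delta^n$ and beneath all the others. Two polytopes are combinatorially equivalent if their face lattices are isomorphic. *)

theory Defs
  imports "HOL-Analysis.Analysis" "HOL-Library.Multiset"
begin

abbreviation vertices_of :: "'a::euclidean_space set \<Rightarrow> 'a set" where
  "vertices_of P \<equiv> {v. v extreme_point_of P}"

definition faces2 :: "'a::euclidean_space set \<Rightarrow> 'a set set" where
  "faces2 P = {f. f face_of P \<and> aff_dim f = 2}"

definition simple_3_polytope :: "'a::euclidean_space set \<Rightarrow> bool" where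
  "simple_3_polytope P \<longleftrightarrow>
     polytope P \<and> aff_dim P = 3 \<and>
     (\<forall>v \<in> vertices_of P. card {f \<in> faces2 P. v \<in> f} = 3)"

text \<open>Facets are adjacent when they share an edge.\<close>

definition proper_3_coloring :: "'a::euclidean_space set \<Rightarrow> ('a set \<Rightarrow> nat) \<Rightarrow> bool" where
  "proper_3_coloring P c \<longleftrightarrow>
     (\<forall>f \<in> faces2 P. c f \<in> {1, 2, 3}) \<and>
     (\<forall>f \<in> faces2 P. \<forall>g \<in> faces2 P. f \<noteq> g \<and> (f \<inter> g) edge_of P \<longrightarrow> c f \<noteq> c g)"

definition three_colorable :: "'a::euclidean_space set \<Rightarrow> bool" where
  "three_colorable P \<longleftrightarrow> simple_3_polytope P \<and> (\<exists>c. proper_3_coloring P c)"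

text \<open>The coordinates of the incidence vectors are indexed by a finite type \<open>'v\<close>;
  \<open>vert\<close> is the chosen numbering of the vertices of the polytope by this type.\<close>

definition incidence_vector :: "('v::finite \<Rightarrow> 'a) \<Rightarrow> 'a set \<Rightarrow> real^'v" where
  "incidence_vector vert f = (\<chi> i. if vert i \<in> f then 1 else 0)"

text \<open>The null space of the matrix with columns \<open>(1, v i)\<close>, for \<open>i \<in> I\<close>. Its elements are
  the real functions on \<open>I\<close>; values outside \<open>I\<close> are irrelevant.\<close>

definition null_space :: "'i set \<Rightarrow> ('i \<Rightarrow> 'v::real_vector) \<Rightarrow> ('i \<Rightarrow> real) set" where
  "null_space I v = {w. (\<Sum>i\<in>I. w i) = 0 \<and> (\<Sum>i\<in>I. w i *\<^sub>R v i) = 0}"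

text \<open>The family \<open>(\<beta> b)\<close>, for \<open>b \<in> B\<close>, is a basis of the space \<open>N\<close> of functions on \<open>I\<close>:
  it lies in \<open>N\<close>, is linearly independent, and spans \<open>N\<close>.\<close>

definition function_basis ::
    "'i set \<Rightarrow> ('i \<Rightarrow> real) set \<Rightarrow> 'b set \<Rightarrow> ('b \<Rightarrow> 'i \<Rightarrow> real) \<Rightarrow> bool" where
  "function_basis I N B \<beta> \<longleftrightarrow>
     (\<forall>b\<in>B. \<beta> b \<in> N) \<and>
     (\<forall>u. (\<forall>i\<in>I. (\<Sum>b\<in>B. u b * \<beta> b i) = 0) \<longrightarrow> (\<forall>b\<in>B. u b = 0)) \<and>
     (\<forall>w\<in>N. \<exists>u. \<forall>i\<in>I. w i = (\<Sum>b\<in>B. u b * \<beta> b i))"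

text \<open>The list of vectors is a finite family \<open>v\<close> indexed by \<open>I\<close>. The space
  \<open>\<real>\<^sup>N\<^sup>-\<^sup>d\<^sup>-\<^sup>1\<close> is any Euclidean space \<open>'g\<close> of that dimension, and the basis vectors of the
  null space are indexed by the standard basis of \<open>'g\<close>.\<close>

definition gale_transform ::
    "'i set \<Rightarrow> ('i \<Rightarrow> 'v::euclidean_space) \<Rightarrow> ('i \<Rightarrow> 'g::euclidean_space) \<Rightarrow> bool" where
  "gale_transform I v g \<longleftrightarrow>
     finite I \<and>
     int DIM('g) = int (card I) - aff_dim (convex hull (v ` I)) - 1 \<and>
     (\<exists>\<beta>. function_basis I (null_space I v) (Basis :: 'g set) \<beta> \<and>
          (\<forall>i\<in>I. \<forall>b\<in>Basis. g i \<bullet> b = \<beta> b i))"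

definition gale_diagram ::
    "'i set \<Rightarrow> ('i \<Rightarrow> 'v::euclidean_space) \<Rightarrow> ('i \<Rightarrow> 'g::euclidean_space) \<Rightarrow> bool" where
  "gale_diagram I v d \<longleftrightarrow>
     (\<exists>g. gale_transform I v g \<and>
          (\<forall>i\<in>I. d i = (if g i = 0 then 0 else g i /\<^sub>R norm (g i))))"

definition polytope_gale_diagram ::
    "'v::euclidean_space set \<Rightarrow> ('v \<Rightarrow> 'g::euclidean_space) \<Rightarrow> bool" where
  "polytope_gale_diagram Q d \<longleftrightarrow> polytope Q \<and> gale_diagram (vertices_of Q) (\<lambda>x. x) d"

definition proper_face_of :: "'a::real_vector set \<Rightarrow> 'a set \<Rightarrow> bool"
    (infixr \<open>proper'_face'_of\<close> 50) where
  "F proper_face_of Q \<longleftrightarrow> F face_of Q \<and> F \<noteq> Q"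

text \<open>The empty face is the simplex of dimension \<open>-1\<close>.\<close>

definition simplicial_polytope :: "'a::euclidean_space set \<Rightarrow> bool" where
  "simplicial_polytope Q \<longleftrightarrow>
     polytope Q \<and> (\<forall>F. F proper_face_of Q \<longrightarrow> (\<exists>k. k simplex F))"

definition beyond :: "'a::euclidean_space \<Rightarrow> 'a set \<Rightarrow> 'a set \<Rightarrow> bool" where
  "beyond v F Q \<longleftrightarrow>
     (\<exists>a b. a \<noteq> 0 \<and> affine hull F = {x. a \<bullet> x = b} \<and>
            (\<forall>x \<in> interior Q. a \<bullet> x < b) \<and> a \<bullet> v > b)"

definition beneath :: "'a::euclidean_space \<Rightarrow> 'a set \<Rightarrow> 'a set \<Rightarrow> bool" where
  "beneath v F Q \<longleftrightarrow>
     (\<exists>a b. a \<noteq> 0 \<and> affine hull F = {x. a \<bullet> x = b} \<and>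
            (\<forall>x \<in> interior Q. a \<bullet> x < b) \<and> a \<bullet> v < b)"

text \<open>The data from which \<open>T\<^sup>n\<^sub>k\<close> is built, with \<open>n\<close> the dimension of the ambient space;
  the polytope itself is \<open>convex hull (insert v \<Delta>)\<close>.\<close>

definition T_data :: "nat \<Rightarrow> 'a::euclidean_space set \<Rightarrow> 'a \<Rightarrow> bool" where
  "T_data k \<Delta> v \<longleftrightarrow>
     int DIM('a) simplex \<Delta> \<and>
     card {F. F facet_of \<Delta> \<and> beyond v F \<Delta>} = k \<and>
     (\<forall>F. F facet_of \<Delta> \<and> \<not> beyond v F \<Delta> \<longrightarrow> beneath v F \<Delta>)"

text \<open>An isomorphism of lattices is the same as an isomorphism of the underlying orders.\<close>

definition combinatorially_equivalent ::
    "'a::euclidean_space set \<Rightarrow> 'b::euclidean_space set \<Rightarrow> bool" where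
  "combinatorially_equivalent P Q \<longleftrightarrow>
     (\<exists>\<phi>. bij_betw \<phi> {F. F face_of P} {G. G face_of Q} \<and>
          (\<forall>F F'. F face_of P \<and> F' face_of P \<longrightarrow> (F \<subseteq> F' \<longleftrightarrow> \<phi> F \<subseteq> \<phi> F')))"

end

theory Submission
  imports Defs
begin

text \<open>
  The polytope is determined, up to combinatorial equivalence, by the signs of a single affine
  dependence among its vertices.

  At a vertex of a simple 3-polytope any two of the three faces share an edge, so a proper
  colouring shows each colour exactly once there, and the incidence vectors of the faces of one
  colour add up to the all-ones vector. Conversely, a linear dependence of incidence vectors gives
  every face a coefficient such that the three coefficients at each vertex add up to zero. The two
  ends of an edge have two faces in common, so the remaining two faces, which have the same colour,
  have equal coefficients; the graph of the polytope being connected, the coefficient of a face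
  depends only on its colour (\<open>dependency_constant_on_colours\<close>). An affine dependence is therefore a
  triple with \<open>t\<^sub>1 + t\<^sub>2 + t\<^sub>3 = 0\<close> and \<open>m\<^sub>1 t\<^sub>1 + m\<^sub>2 t\<^sub>2 + m\<^sub>3 t\<^sub>3 = 0\<close>, that is, a multiple of
  \<open>(m\<^sub>2 - m\<^sub>3, m\<^sub>3 - m\<^sub>1, m\<^sub>1 - m\<^sub>2)\<close>, whose signs are \<open>-, +, -\<close>
  (\<open>incidence_vectors_circuit\<close>).

  A point set with an affine dependence that vanishes nowhere and is unique up to scaling is
  treated in the locale \<open>signed_circuit\<close>. A subset spans a proper face exactly if it misses a point
  of positive and a point of negative sign: if it misses both, two representations of a point can
  only differ by the zero multiple of the dependence; if it contains one part, the face contains the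
  Radon point of the dependence, which is relatively interior to the hull of the other part. Proper subsets are
  affinely independent, so the polytope is simplicial, and its face lattice depends only on the
  sizes of the two parts.

  A simplex together with one point \<open>v\<close> in general position is of this kind too: the dependence
  writes \<open>v\<close> in barycentric coordinates, and the coordinate of a vertex is negative exactly if \<open>v\<close> is
  beyond the opposite facet (\<open>T_data_signed_circuit\<close>). Comparing the sizes of the parts needs the
  number \<open>n + 2\<close> of faces of a simple 3-polytope with \<open>2n\<close> vertices. It follows from a count of the
  minimal and maximal vertices of the faces with respect to a linear functional
  (\<open>two_card_faces2\<close>), and the same functional, decreased along edges, gives the connectedness of
  the graph.
\<close>

section \<open>Polytopes whose vertices have a unique affine dependence\<close>

text \<open>
  The parts \<open>A\<close> and \<open>B\<close> carry the positive and the negative coefficients of the dependence. Two points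
  in each part make every single point a face, so that all points are vertices of the hull.
\<close>
locale signed_circuit =
  fixes A B :: "'a::euclidean_space set" and w :: "'a \<Rightarrow> real"
  assumes finite: "finite A" "finite B"
    and disjoint: "A \<inter> B = {}"
    and pos: "x \<in> A \<Longrightarrow> 0 < w x"
    and neg: "x \<in> B \<Longrightarrow> w x < 0"
    and dependence: "w \<in> null_space (A \<union> B) (\<lambda>x. x)"
    and unique: "u \<in> null_space (A \<union> B) (\<lambda>x. x) \<Longrightarrow> \<exists>r. \<forall>x\<in>A \<union> B. u x = r * w x"
    and two_pos: "2 \<le> card A" and two_neg: "2 \<le> card B"
begin

abbreviation "S \<equiv> A \<union> B"

lemma nonempty: "A \<noteq> {}" "B \<noteq> {}"
  using two_pos two_neg by auto

lemma nonzero: "x \<in> S \<Longrightarrow> w x \<noteq> 0"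
  using pos neg by force

lemma finite_S: "finite S"
  using finite by simp

lemma swap: "signed_circuit B A (\<lambda>x. - w x)"
proof
  show "(\<lambda>x. - w x) \<in> null_space (B \<union> A) (\<lambda>x. x)"
    using dependence by (simp add: null_space_def sum_negf Un_commute)
  show "\<exists>r. \<forall>x\<in>B \<union> A. u x = r * - w x" if u: "u \<in> null_space (B \<union> A) (\<lambda>x. x)" for u
  proof -
    obtain r where "\<forall>x\<in>S. u x = r * w x"
      using unique u by (metis Un_commute)
    then show ?thesis
      by (intro exI[of _ "-r"]) auto
  qed
qed (use finite disjoint pos neg two_pos two_neg in auto)

text \<open>
  Two equal combinations over disjoint sets differ by a dependence, hence by some multiple \<open>r\<close> of \<open>w\<close>;
  a point that occurs in neither of them forces \<open>r = 0\<close>.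
\<close>
lemma dependence_on_subset:
  assumes "J \<subseteq> S" "K \<subseteq> S" "J \<inter> K = {}"
    and "sum p J = sum q K" "(\<Sum>x\<in>J. p x *\<^sub>R x) = (\<Sum>x\<in>K. q x *\<^sub>R x)"
  obtains r where "\<And>x. x \<in> J \<Longrightarrow> p x = r * w x" "\<And>x. x \<in> K \<Longrightarrow> - q x = r * w x"
    "\<And>x. x \<in> S - J - K \<Longrightarrow> r = 0"
proof -
  define u where "u = (\<lambda>x. (if x \<in> J then p x else 0) - (if x \<in> K then q x else 0))"
  have J: "S \<inter> J = J" and K: "S \<inter> K = K"
    using assms by auto
  have "sum u S = 0"
    using assms(4) finite_S J K
    by (simp add: u_def sum_subtractf sum.inter_restrict[symmetric])
  moreover have "(\<Sum>x\<in>S. u x *\<^sub>R x) = 0"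
  proof -
    have "(\<Sum>x\<in>S. u x *\<^sub>R x)
        = (\<Sum>x\<in>S. if x \<in> J then p x *\<^sub>R x else 0) - (\<Sum>x\<in>S. if x \<in> K then q x *\<^sub>R x else 0)"
      unfolding sum_subtractf[symmetric]
      by (rule sum.cong) (auto simp: u_def algebra_simps)
    then show ?thesis
      using assms(5) finite_S J K by (simp add: sum.inter_restrict[symmetric])
  qed
  ultimately obtain r where r: "\<And>x. x \<in> S \<Longrightarrow> u x = r * w x"
    using unique[of u] by (auto simp: null_space_def)
  show thesis
  proof
    show "p x = r * w x" if x: "x \<in> J" for x
    proof -
      have "x \<in> S" "x \<notin> K"
        using x assms by auto
      then show ?thesis
        using r[of x] x by (simp add: u_def)
    qed
    show "- q x = r * w x" if x: "x \<in> K" for x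
    proof -
      have "x \<in> S" "x \<notin> J"
        using x assms by auto
      then show ?thesis
        using r[of x] x by (simp add: u_def)
    qed
    show "r = 0" if "x \<in> S - J - K" for x
      using that r[of x] nonzero[of x] by (auto simp: u_def)
  qed
qed

lemma proper_subset_independent:
  assumes "J \<subset> S"
  shows "\<not> affine_dependent J"
proof
  have fin: "finite J"
    using assms finite_S by (meson finite_subset psubset_imp_subset)
  assume "affine_dependent J"
  then obtain p v where p: "sum p J = 0" "v \<in> J" "p v \<noteq> 0" "(\<Sum>x\<in>J. p x *\<^sub>R x) = 0"
    using affine_dependent_explicit_finite[OF fin] by auto
  obtain s where s: "s \<in> S - J"
    using assms by auto
  obtain r where r: "\<And>x. x \<in> J \<Longrightarrow> p x = r * w x" "\<And>x. x \<in> S - J - {} \<Longrightarrow> r = 0"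
    using dependence_on_subset[of J "{}" p "\<lambda>x. 0"] assms p by auto
  then show False
    using s p by fastforce
qed

text \<open>
  This is the Gale criterion for a face. In a common point the coefficients \<open>q\<close> over the complement
  satisfy \<open>- q = r w\<close>, and \<open>q\<close> is nonnegative: a positive point outside \<open>J\<close> gives \<open>r \<le> 0\<close>, a negative one
  gives \<open>r \<ge> 0\<close>, so \<open>q\<close> vanishes although it has sum 1.
\<close>
lemma affine_hull_disjoint:
  assumes "J \<subseteq> S" "\<not> A \<subseteq> J" "\<not> B \<subseteq> J"
  shows "affine hull J \<inter> convex hull (S - J) = {}"
proof (rule ccontr)
  assume "\<not> ?thesis"
  then obtain x where x: "x \<in> affine hull J" "x \<in> convex hull (S - J)"
    by auto
  have fin: "finite J" "finite (S - J)"
    using assms finite_S by (auto intro: finite_subset)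
  obtain p where p: "sum p J = 1" "(\<Sum>y\<in>J. p y *\<^sub>R y) = x"
    using x(1) by (auto simp: affine_hull_finite[OF fin(1)])
  obtain q where q: "\<And>y. y \<in> S - J \<Longrightarrow> 0 \<le> q y" "sum q (S - J) = 1" "(\<Sum>y\<in>S - J. q y *\<^sub>R y) = x"
    using x(2) by (auto simp: convex_hull_finite[OF fin(2)])
  obtain r where r: "\<And>y. y \<in> S - J \<Longrightarrow> - q y = r * w y"
    using dependence_on_subset[of J "S - J" p q] assms(1) p q by (metis Diff_disjoint Diff_subset)
  obtain a b where ab: "a \<in> A" "a \<notin> J" "b \<in> B" "b \<notin> J"
    using assms by auto
  have "r * w a \<le> 0" "r * w b \<le> 0"
    using r[of a] r[of b] q(1)[of a] q(1)[of b] ab by auto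
  then have "r = 0"
    using pos[OF ab(1)] neg[OF ab(3)] by (simp add: mult_le_0_iff)
  then have "sum q (S - J) = 0"
    using r by (intro sum.neutral) auto
  then show False
    using q by simp
qed

lemma face_if:
  assumes "J \<subseteq> S" "\<not> A \<subseteq> J" "\<not> B \<subseteq> J"
  shows "convex hull J face_of convex hull S" "convex hull J \<inter> S = J"
proof -
  show "convex hull J face_of convex hull S"
    using face_of_convex_hulls[OF finite_S assms(1)] affine_hull_disjoint[OF assms] by blast
  have "s \<notin> convex hull J" if "s \<in> S - J" for s
    using that affine_hull_disjoint[OF assms] convex_hull_subset_affine_hull[of J] hull_inc[of s "S - J" convex]
    by auto
  then show "convex hull J \<inter> S = J"
    using assms(1) hull_subset[of J convex] by auto
qed

text \<open>
  The Radon point \<open>z\<close> of the dependence lies in the hull of \<open>A\<close> and, all coefficients on \<open>B\<close> being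
  nonzero, in the relative interior of the hull of \<open>B\<close>. A face that contains a relative interior
  point of the hull of \<open>B\<close> contains all of \<open>B\<close>.
\<close>
lemma face_with_positive_part:
  assumes "F face_of convex hull S" "A \<subseteq> F"
  shows "F = convex hull S"
proof -
  define W where "W = sum w A"
  define z where "z = (\<Sum>x\<in>A. (w x / W) *\<^sub>R x)"
  have W: "W > 0"
    unfolding W_def using pos finite two_pos by (intro sum_pos) auto
  have WB: "sum w B = - W"
    using dependence finite disjoint by (simp add: null_space_def sum.union_disjoint W_def)
  have "(\<Sum>x\<in>A. w x *\<^sub>R x) = - (\<Sum>x\<in>B. w x *\<^sub>R x)"
    using dependence finite disjoint
    by (simp add: null_space_def sum.union_disjoint eq_neg_iff_add_eq_0)
  then have zB: "z = (\<Sum>x\<in>B. (- w x / W) *\<^sub>R x)"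
    by (simp add: z_def divide_inverse_commute scaleR_sum_right[symmetric] sum_negf
        scaleR_scaleR[symmetric] del: scaleR_scaleR)
  have "z \<in> convex hull A"
    unfolding z_def
    by (rule convex_sum) (use finite pos W in \<open>auto simp: W_def hull_inc less_imp_le
          sum_divide_distrib[symmetric]\<close>)
  also have "convex hull A \<subseteq> F"
    using assms by (meson face_of_imp_convex hull_minimal)
  finally have zF: "z \<in> F" .
  have "z \<in> rel_interior (convex hull B)"
  proof -
    have "(\<forall>x\<in>B. 0 < - w x / W) \<and> (\<Sum>x\<in>B. - w x / W) = 1"
      using W WB neg by (auto simp: sum_divide_distrib[symmetric] sum_negf divide_neg_pos)
    then show ?thesis
      using zB by (intro subsetD[OF explicit_subset_rel_interior_convex_hull_minimal[OF finite(2)]])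
        (auto intro!: exI[of _ "\<lambda>x. - w x / W"])
  qed
  then have "convex hull B \<subseteq> F"
    using subset_of_face_of[OF assms(1), of "convex hull B"] zF hull_mono[of B S convex] by auto
  then have "S \<subseteq> F"
    using assms(2) hull_subset[of B convex] by auto
  then have "convex hull S \<subseteq> F"
    using assms(1) by (meson face_of_imp_convex hull_minimal)
  then show ?thesis
    using assms(1) face_of_imp_subset by blast
qed

lemma proper_face_iff:
  assumes "J \<subseteq> S"
  shows "(convex hull J) proper_face_of (convex hull S) \<longleftrightarrow> \<not> A \<subseteq> J \<and> \<not> B \<subseteq> J"
proof
  assume F: "(convex hull J) proper_face_of (convex hull S)"
  have "\<not> A \<subseteq> J"
    using face_with_positive_part[of "convex hull J"] F hull_subset[of J convex]
    by (auto simp: proper_face_of_def)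
  moreover have "\<not> B \<subseteq> J"
    using signed_circuit.face_with_positive_part[OF swap, of "convex hull J"] F hull_subset[of J convex]
    by (auto simp: proper_face_of_def Un_commute)
  ultimately show "\<not> A \<subseteq> J \<and> \<not> B \<subseteq> J"
    by simp
next
  assume J: "\<not> A \<subseteq> J \<and> \<not> B \<subseteq> J"
  have "convex hull J \<noteq> convex hull S"
    using face_if(2)[OF assms] J hull_subset[of S convex] by auto
  then show "(convex hull J) proper_face_of (convex hull S)"
    using face_if(1)[OF assms] J by (simp add: proper_face_of_def)
qed

text \<open>
  These turn out to be the vertex sets of the faces, the whole polytope included.
\<close>
definition face_sets :: "'a set set" where
  "face_sets = insert S {J. J \<subseteq> S \<and> \<not> A \<subseteq> J \<and> \<not> B \<subseteq> J}"

lemma convex_hull_Int: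
  assumes "J \<in> face_sets"
  shows "convex hull J \<inter> S = J"
proof (cases "J = S")
  case True
  then show ?thesis
    using hull_subset[of S convex] by blast
next
  case False
  then show ?thesis
    using assms face_if(2)[of J] by (simp add: face_sets_def)
qed

lemma face_cases:
  assumes "F face_of convex hull S"
  obtains J where "J \<in> face_sets" "F = convex hull J"
proof (cases "F = convex hull S")
  case True
  then show thesis
    using that by (auto simp: face_sets_def)
next
  case False
  obtain J where J: "J \<subseteq> S" "F = convex hull J"
    using face_of_convex_hull_subset[OF finite_imp_compact[OF finite_S] assms] by blast
  then show thesis
    using that[of J] False assms proper_face_iff[of J] by (auto simp: face_sets_def proper_face_of_def)
qed

lemma face_sets_bij: "bij_betw (\<lambda>J. convex hull J) face_sets {F. F face_of convex hull S}"
proof (rule bij_betw_imageI)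
  show "inj_on (\<lambda>J. convex hull J) face_sets"
    by (metis convex_hull_Int inj_onI)
  show "(\<lambda>J. convex hull J) ` face_sets = {F. F face_of convex hull S}"
  proof (intro equalityI subsetI)
    fix F assume "F \<in> (\<lambda>J. convex hull J) ` face_sets"
    then show "F \<in> {F. F face_of convex hull S}"
      using face_if(1) by (auto simp: face_sets_def face_of_refl)
  qed (use face_cases in blast)
qed

lemma face_sets_mono:
  assumes "J \<in> face_sets" "J' \<in> face_sets"
  shows "convex hull J \<subseteq> convex hull J' \<longleftrightarrow> J \<subseteq> J'"
  by (metis assms convex_hull_Int hull_mono inf_mono order_refl)

lemma vertices: "vertices_of (convex hull S) = S"
proof
  show "vertices_of (convex hull S) \<subseteq> S"
    by (rule extreme_points_of_convex_hull)
  have "\<not> A \<subseteq> {s}" "\<not> B \<subseteq> {s}" for s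
    using two_pos two_neg card_mono[of "{s}" A] card_mono[of "{s}" B] by force+
  then show "S \<subseteq> vertices_of (convex hull S)"
    using face_if(1)[of "{s}" for s] by (auto simp: face_of_singleton)
qed

lemma simplicial: "simplicial_polytope (convex hull S)"
  unfolding simplicial_polytope_def
proof (intro conjI allI impI)
  show "polytope (convex hull S)"
    using finite_S by (rule polytope_convex_hull)
  fix F assume F: "F proper_face_of convex hull S"
  then obtain J where J: "J \<in> face_sets" "F = convex hull J"
    using face_cases by (auto simp: proper_face_of_def)
  then have "J \<subset> S"
    using F by (auto simp: face_sets_def proper_face_of_def)
  then show "\<exists>k. k simplex F"
    using proper_subset_independent[of J] J(2)
    by (auto simp: simplex_def intro!: exI[of _ "int (card J) - 1"])
qed

text \<open>
  Deleting one point of the circuit leaves an affinely independent set with the same affine hull.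
\<close>
lemma aff_dim: "aff_dim (convex hull S) = int (card S) - 2"
proof -
  obtain a where a: "a \<in> A"
    using nonempty by blast
  have S: "insert a (S - {a}) = S"
    using a by auto
  have ind: "\<not> affine_dependent (S - {a})"
    using a by (intro proper_subset_independent) auto
  have dep: "affine_dependent S"
    using dependence a nonzero affine_dependent_explicit_finite[OF finite_S]
    by (auto simp: null_space_def intro!: exI[of _ w])
  have "a \<in> affine hull (S - {a})"
    using dep ind S affine_independent_insert[of "S - {a}" a] by force
  then have "aff_dim S = aff_dim (S - {a})"
    using S by (metis aff_dim_insert)
  also have "\<dots> = int (card (S - {a})) - 1"
    using aff_dim_affine_independent[OF ind] by simp
  also have "int (card (S - {a})) = int (card S) - 1"
    using a finite_S by (metis S Un_iff card.remove[OF finite_S] of_nat_Suc add_diff_cancel_left')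
  finally show ?thesis
    by (simp add: aff_dim_convex_hull)
qed

text \<open>
  The null space is the line spanned by \<open>w\<close>, so \<open>w\<close> is a Gale transform in dimension one, and
  normalizing a nonzero real number leaves its sign.
\<close>
lemma gale_diagram_signs:
  "polytope_gale_diagram (convex hull S) (sgn \<circ> w)"
proof -
  have "gale_transform S (\<lambda>x. x) w"
    unfolding gale_transform_def
  proof (intro conjI exI[of _ "\<lambda>_. w"])
    show "int DIM(real) = int (card S) - aff_dim (convex hull ((\<lambda>x. x) ` S)) - 1"
      by (simp add: aff_dim)
    show "function_basis S (null_space S (\<lambda>x. x)) (Basis :: real set) (\<lambda>_. w)"
      unfolding function_basis_def
    proof (intro conjI allI ballI impI)
      fix u :: "real \<Rightarrow> real" and b :: real
      assume "\<forall>i\<in>S. (\<Sum>b\<in>(Basis :: real set). u b * w i) = 0" "b \<in> Basis"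
      moreover obtain s where "s \<in> S"
        using nonempty by blast
      ultimately show "u b = 0"
        using nonzero by fastforce
    next
      fix v assume "v \<in> null_space S (\<lambda>x. x)"
      then obtain r where "\<forall>x\<in>S. v x = r * w x"
        using unique by blast
      then show "\<exists>u. \<forall>i\<in>S. v i = (\<Sum>b\<in>(Basis :: real set). u b * w i)"
        by (intro exI[of _ "\<lambda>_. r"]) simp
    qed (use dependence in simp)
  qed (use finite_S in auto)
  then show ?thesis
    using finite_S nonzero
    by (auto simp: polytope_gale_diagram_def polytope_convex_hull vertices gale_diagram_def
        sgn_real_def intro!: exI[of _ w])
qed

end

text \<open>
  Membership in \<open>face_sets\<close> only refers to inclusions between a set and the two parts, so a bijection
  of the vertices that matches the parts induces an isomorphism of the face lattices.
\<close>
lemma signed_circuits_combinatorially_equivalent: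
  fixes A B :: "'a::euclidean_space set" and A' B' :: "'b::euclidean_space set"
  assumes "signed_circuit A B w" "signed_circuit A' B' w'"
    and "card A = card A'" "card B = card B'"
  shows "combinatorially_equivalent (convex hull (A \<union> B)) (convex hull (A' \<union> B'))"
proof -
  interpret C: signed_circuit A B w by fact
  interpret D: signed_circuit A' B' w' by fact
  obtain f g where f: "bij_betw f A A'" and g: "bij_betw g B B'"
    using assms(3,4) C.finite D.finite by (metis finite_same_card_bij)
  define h where "h = (\<lambda>x. if x \<in> A then f x else g x)"
  have hA: "bij_betw h A A'"
    using f by (rule bij_betw_cong[THEN iffD1, rotated]) (simp add: h_def)
  have hB: "bij_betw h B B'"
    using g by (rule bij_betw_cong[THEN iffD1, rotated]) (use C.disjoint in \<open>auto simp: h_def\<close>)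
  have h: "bij_betw h C.S D.S"
    using hA hB D.disjoint by (rule bij_betw_combine)
  have sub: "h ` J \<subseteq> h ` K \<longleftrightarrow> J \<subseteq> K" if "J \<subseteq> C.S" "K \<subseteq> C.S" for J K
    using that h by (meson bij_betw_imp_inj_on inj_on_image_subset_iff)
  have images: "h ` A = A'" "h ` B = B'" "h ` C.S = D.S"
    using hA hB h by (auto simp: bij_betw_def)
  have im: "bij_betw (image h) C.face_sets D.face_sets"
  proof (rule bij_betw_imageI)
    have "J \<subseteq> C.S" if "J \<in> C.face_sets" for J
      using that by (auto simp: C.face_sets_def)
    then show "inj_on (image h) C.face_sets"
      by (intro inj_onI) (metis sub order_antisym order_refl)
    have mem: "J \<in> C.face_sets \<longleftrightarrow> h ` J \<in> D.face_sets" if "J \<subseteq> C.S" for J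
    proof -
      have "h ` J = D.S \<longleftrightarrow> J = C.S"
        using sub[of J C.S] sub[of C.S J] that images by (metis order_antisym order_refl)
      moreover have "A' \<subseteq> h ` J \<longleftrightarrow> A \<subseteq> J" "B' \<subseteq> h ` J \<longleftrightarrow> B \<subseteq> J" "h ` J \<subseteq> D.S"
        using sub[of A J] sub[of B J] sub[of J C.S] that images by auto
      ultimately show ?thesis
        using that by (simp add: C.face_sets_def D.face_sets_def)
    qed
    show "(image h) ` C.face_sets = D.face_sets"
    proof (intro equalityI subsetI)
      fix K assume "K \<in> (image h) ` C.face_sets"
      then show "K \<in> D.face_sets"
        using mem by (auto simp: C.face_sets_def)
    next
      fix K assume K: "K \<in> D.face_sets"
      then have "K \<subseteq> h ` C.S"
        unfolding images(3) by (auto simp: D.face_sets_def)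
      then obtain J where "J \<subseteq> C.S" "K = h ` J"
        by (rule subset_imageE)
      then show "K \<in> (image h) ` C.face_sets"
        using K mem by simp
    qed
  qed
  define k where "k = inv_into C.face_sets (\<lambda>J. convex hull J)"
  have k: "bij_betw k {F. F face_of convex hull C.S} C.face_sets"
    unfolding k_def by (rule bij_betw_inv_into[OF C.face_sets_bij])
  have hull_k: "convex hull (k F) = F" if "F face_of convex hull C.S" for F
    using that C.face_sets_bij unfolding k_def
    by (metis (mono_tags, lifting) bij_betw_imp_surj_on f_inv_into_f mem_Collect_eq)
  let ?\<phi> = "(\<lambda>J. convex hull J) \<circ> (image h \<circ> k)"
  have "bij_betw ?\<phi> {F. F face_of convex hull C.S} {F. F face_of convex hull D.S}"
    using bij_betw_trans[OF bij_betw_trans[OF k im] D.face_sets_bij] .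
  moreover have "F \<subseteq> F' \<longleftrightarrow> ?\<phi> F \<subseteq> ?\<phi> F'"
    if F: "F face_of convex hull C.S" "F' face_of convex hull C.S" for F F'
  proof -
    have mem: "k F \<in> C.face_sets" "k F' \<in> C.face_sets"
      using F bij_betwE[OF k] by auto
    then have "F \<subseteq> F' \<longleftrightarrow> k F \<subseteq> k F'"
      using C.face_sets_mono[OF mem] F hull_k by simp
    also have "\<dots> \<longleftrightarrow> h ` k F \<subseteq> h ` k F'"
      using mem by (intro sub[symmetric]) (auto simp: C.face_sets_def)
    also have "\<dots> \<longleftrightarrow> ?\<phi> F \<subseteq> ?\<phi> F'"
      using D.face_sets_mono[of "h ` k F" "h ` k F'"] bij_betwE[OF im] mem by auto
    finally show ?thesis .
  qed
  ultimately show ?thesis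
    unfolding combinatorially_equivalent_def by blast
qed

section \<open>A simplex and one further point\<close>

lemma barycentric_coordinates_unique:
  fixes C :: "'a::euclidean_space set"
  assumes "\<not> affine_dependent C" "sum p C = sum q C" "(\<Sum>x\<in>C. p x *\<^sub>R x) = (\<Sum>x\<in>C. q x *\<^sub>R x)" "c \<in> C"
  shows "p c = q c"
proof (rule ccontr)
  assume "p c \<noteq> q c"
  then have "sum (\<lambda>x. p x - q x) C = 0" "\<exists>x\<in>C. p x - q x \<noteq> 0" "(\<Sum>x\<in>C. (p x - q x) *\<^sub>R x) = 0"
    using assms by (auto simp: sum_subtractf algebra_simps)
  then have "affine_dependent C"
    using affine_dependent_explicit_finite[OF aff_independent_finite[OF assms(1)]] by blast
  then show False
    using assms(1) by simp
qed

lemma barycentric_coordinate_hyperplane: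
  fixes C :: "'a::euclidean_space set"
  assumes "finite C" "c \<in> C" "sum p C = 1" "affine hull (C - {c}) = {x. a \<bullet> x = b}"
  shows "a \<bullet> (\<Sum>x\<in>C. p x *\<^sub>R x) - b = p c * (a \<bullet> c - b)"
proof -
  have "a \<bullet> x = b" if "x \<in> C - {c}" for x
    using that hull_inc[of x "C - {c}" affine] assms(4) by auto
  then have "(\<Sum>x\<in>C - {c}. p x * (a \<bullet> x - b)) = 0"
    by simp
  then have "(\<Sum>x\<in>C. p x * (a \<bullet> x - b)) = p c * (a \<bullet> c - b)"
    using assms(1,2) by (simp add: sum.remove[of C c])
  moreover have "(\<Sum>x\<in>C. p x * (a \<bullet> x - b)) = (\<Sum>x\<in>C. p x * (a \<bullet> x)) - sum p C * b"
    by (simp add: algebra_simps sum_subtractf sum_distrib_left)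
  ultimately show ?thesis
    using assms(3) by (simp add: inner_sum_right)
qed

text \<open>
  An affine function that vanishes on the facet opposite to \<open>c\<close> takes at \<open>v\<close> the value \<open>p c\<close> times its
  value at \<open>c\<close>; as \<open>c\<close> lies on the side of the interior, the sign of \<open>p c\<close> tells the side of \<open>v\<close>.
\<close>
lemma simplex_facet_sides:
  fixes C :: "'a::euclidean_space set"
  assumes C: "\<not> affine_dependent C" "card C = DIM('a) + 1" and c: "c \<in> C" and p: "sum p C = 1"
  defines "v \<equiv> (\<Sum>x\<in>C. p x *\<^sub>R x)"
  shows "beyond v (convex hull (C - {c})) (convex hull C) \<longleftrightarrow> p c < 0"
    and "beneath v (convex hull (C - {c})) (convex hull C) \<longleftrightarrow> 0 < p c"
proof -
  have fin: "finite C"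
    using C(1) by (rule aff_independent_finite)
  have "affine hull C = UNIV"
    using C by (intro affine_independent_span_eq) auto
  then have "interior (convex hull C) \<noteq> {}"
    using rel_interior_interior[of "convex hull C"] rel_interior_eq_empty[of "convex hull C"] c by auto
  then have closure: "closure (interior (convex hull C)) = convex hull C"
    using fin by (simp add: convex_closure_interior closure_closed compact_imp_closed
        finite_imp_compact_convex_hull)
  have inner_c: "a \<bullet> c < b"
    if H: "affine hull (C - {c}) = {x. a \<bullet> x = b}" "\<forall>x\<in>interior (convex hull C). a \<bullet> x < b" for a b
  proof -
    have "closure (interior (convex hull C)) \<subseteq> {x. a \<bullet> x \<le> b}"
      by (rule closure_minimal) (use H(2) in \<open>auto simp: closed_halfspace_le less_imp_le\<close>)
    then have "a \<bullet> c \<le> b"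
      using c closure by (auto simp: hull_inc)
    moreover have "c \<notin> affine hull (C - {c})"
      using C(1) c by (auto simp: affine_dependent_def)
    ultimately show ?thesis
      using H(1) by auto
  qed
  have value_v: "a \<bullet> v - b = p c * (a \<bullet> c - b)" if "affine hull (C - {c}) = {x. a \<bullet> x = b}" for a b
    unfolding v_def using barycentric_coordinate_hyperplane[OF fin c p that] .
  obtain a b where ab: "a \<noteq> 0" "affine hull (C - {c}) = {x. a \<bullet> x = b}"
    "\<forall>x\<in>interior (convex hull C). a \<bullet> x < b"
  proof -
    have "\<not> affine_dependent (C - {c})"
      using C(1) by (rule affine_independent_Diff)
    then have "aff_dim (C - {c}) = int (DIM('a) - 1)"
      using aff_dim_affine_independent[of "C - {c}"] C(2) c fin by (simp add: of_nat_diff Suc_leI)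
    then obtain a0 b0 where ab0: "a0 \<noteq> 0" "affine hull (C - {c}) = {x. a0 \<bullet> x = b0}"
      using aff_dim_eq_hyperplane[of "C - {c}"] by auto
    have "c \<notin> affine hull (C - {c})"
      using C(1) c by (auto simp: affine_dependent_def)
    then have "a0 \<bullet> c \<noteq> b0"
      using ab0 by auto
    \<comment> \<open>The sign \<open>s\<close> orients the hyperplane so that \<open>c\<close>, and with it the interior, lies below it.\<close>
    define s where "s = (if a0 \<bullet> c < b0 then 1 else - 1 :: real)"
    have s: "s *\<^sub>R a0 \<noteq> 0" "affine hull (C - {c}) = {x. (s *\<^sub>R a0) \<bullet> x = s * b0}"
        "(s *\<^sub>R a0) \<bullet> c < s * b0"
      using ab0 \<open>a0 \<bullet> c \<noteq> b0\<close> by (auto simp: s_def)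
    have "(s *\<^sub>R a0) \<bullet> x \<le> s * b0" if "x \<in> C" for x
      using that s(2,3) hull_inc[of x "C - {c}" affine] by (cases "x = c") auto
    then have "convex hull C \<subseteq> {x. (s *\<^sub>R a0) \<bullet> x \<le> s * b0}"
      by (intro hull_minimal convex_halfspace_le) auto
    then have "interior (convex hull C) \<subseteq> {x. (s *\<^sub>R a0) \<bullet> x < s * b0}"
      using interior_mono interior_halfspace_le[OF s(1)] by metis
    then show thesis
      using that[OF s(1,2)] by blast
  qed
  show "beyond v (convex hull (C - {c})) (convex hull C) \<longleftrightarrow> p c < 0"
  proof
    assume "beyond v (convex hull (C - {c})) (convex hull C)"
    then obtain a b where H: "affine hull (C - {c}) = {x. a \<bullet> x = b}"
      "\<forall>x\<in>interior (convex hull C). a \<bullet> x < b" "a \<bullet> v > b"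
      by (auto simp: beyond_def)
    then have "p c * (a \<bullet> c - b) > 0" "a \<bullet> c - b < 0"
      using value_v[OF H(1)] inner_c[OF H(1,2)] H(3) by auto
    then show "p c < 0"
      by (simp add: zero_less_mult_iff)
  next
    assume "p c < 0"
    then have "p c * (a \<bullet> c - b) > 0"
      using inner_c[OF ab(2,3)] by (simp add: mult_neg_neg)
    then have "a \<bullet> v > b"
      using value_v[OF ab(2)] by simp
    then show "beyond v (convex hull (C - {c})) (convex hull C)"
      using ab unfolding beyond_def by auto
  qed
  show "beneath v (convex hull (C - {c})) (convex hull C) \<longleftrightarrow> 0 < p c"
  proof
    assume "beneath v (convex hull (C - {c})) (convex hull C)"
    then obtain a b where H: "affine hull (C - {c}) = {x. a \<bullet> x = b}"
      "\<forall>x\<in>interior (convex hull C). a \<bullet> x < b" "a \<bullet> v < b"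
      by (auto simp: beneath_def)
    then have "p c * (a \<bullet> c - b) < 0" "a \<bullet> c - b < 0"
      using value_v[OF H(1)] inner_c[OF H(1,2)] H(3) by auto
    then show "0 < p c"
      by (simp add: mult_less_0_iff)
  next
    assume "0 < p c"
    then have "p c * (a \<bullet> c - b) < 0"
      using inner_c[OF ab(2,3)] by (simp add: mult_pos_neg)
    then have "a \<bullet> v < b"
      using value_v[OF ab(2)] by simp
    then show "beneath v (convex hull (C - {c})) (convex hull C)"
      using ab unfolding beneath_def by auto
  qed
qed

lemma card_facets_beyond:
  fixes C :: "'a::euclidean_space set"
  assumes C: "\<not> affine_dependent C" "card C = DIM('a) + 1" and p: "sum p C = 1"
  defines "v \<equiv> (\<Sum>x\<in>C. p x *\<^sub>R x)"
  shows "card {F. F facet_of (convex hull C) \<and> beyond v F (convex hull C)} = card {c \<in> C. p c < 0}"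
proof -
  have facet: "F facet_of convex hull C \<longleftrightarrow> (\<exists>c\<in>C. F = convex hull (C - {c}))" for F
    using C by (auto simp: facet_of_convex_hull_affine_independent_alt)
  have "{F. F facet_of (convex hull C) \<and> beyond v F (convex hull C)}
      = (\<lambda>c. convex hull (C - {c})) ` {c \<in> C. p c < 0}"
    using simplex_facet_sides(1)[OF C _ p] unfolding facet v_def by blast
  moreover have "inj_on (\<lambda>c. convex hull (C - {c})) C"
  proof (rule inj_onI, rule ccontr)
    fix c d assume cd: "c \<in> C" "d \<in> C" "convex hull (C - {c}) = convex hull (C - {d})" "c \<noteq> d"
    then have "c \<in> convex hull (C - {c})"
      by (simp add: hull_inc)
    then have "c \<in> affine hull (C - {c})"
      using convex_hull_subset_affine_hull by blast
    then show False
      using C(1) cd by (auto simp: affine_dependent_def)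
  qed
  then have "inj_on (\<lambda>c. convex hull (C - {c})) {c \<in> C. p c < 0}"
    by (rule inj_on_subset) auto
  ultimately show ?thesis
    by (simp add: card_image)
qed

text \<open>
  Subtracting the barycentric representation \<open>v = \<Sum> p c * c\<close> from \<open>v\<close> gives the dependence. Its positive
  part consists of \<open>v\<close> and the \<open>k\<close> vertices with negative coordinate, whose opposite facets are those
  that \<open>v\<close> is beyond. It vanishes nowhere because \<open>v\<close> lies on no facet hyperplane. The bounds on \<open>k\<close>
  leave at least two points in each part.
\<close>
lemma T_data_signed_circuit:
  fixes v :: "'a::euclidean_space"
  assumes T: "T_data k \<Delta> v" and k: "1 \<le> k" "k < DIM('a)"
  obtains A B w where "signed_circuit A B w" "card A = k + 1" "card B = DIM('a) + 1 - k"
    "convex hull (insert v \<Delta>) = convex hull (A \<union> B)"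
proof -
  obtain C where C: "\<not> affine_dependent C" "card C = DIM('a) + 1" "\<Delta> = convex hull C"
    using T by (auto simp: T_data_def simplex_def)
  have fin: "finite C"
    using C(1) by (rule aff_independent_finite)
  have "affine hull C = UNIV"
    using C by (intro affine_independent_span_eq) auto
  then have "v \<in> {y. \<exists>u. sum u C = 1 \<and> (\<Sum>x\<in>C. u x *\<^sub>R x) = y}"
    using affine_hull_finite[OF fin] by blast
  then obtain p where p: "sum p C = 1" "v = (\<Sum>x\<in>C. p x *\<^sub>R x)"
    by blast
  define N where "N = {c \<in> C. p c < 0}"
  have cardN: "card N = k"
    using T card_facets_beyond[OF C(1,2) p(1)] by (simp add: T_data_def C(3) N_def p(2))
  have rest: "0 < p c" if c: "c \<in> C - N" for c
  proof -
    have "convex hull (C - {c}) facet_of \<Delta>"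
      using C c by (auto simp: facet_of_convex_hull_affine_independent_alt)
    moreover have "\<not> beyond v (convex hull (C - {c})) \<Delta>"
      using simplex_facet_sides(1)[OF C(1,2) _ p(1), of c] c by (simp add: C(3) N_def p(2))
    ultimately have "beneath v (convex hull (C - {c})) \<Delta>"
      using T by (auto simp: T_data_def)
    then show ?thesis
      using simplex_facet_sides(2)[OF C(1,2) _ p(1), of c] c by (simp add: C(3) p(2))
  qed
  have vC: "v \<notin> C"
  proof
    assume v: "v \<in> C"
    have "p c = (if c = v then 1 else 0)" if "c \<in> C" for c
      by (rule barycentric_coordinates_unique[OF C(1) _ _ that])
        (use p v fin in \<open>simp_all add: if_distrib[of "\<lambda>r. r *\<^sub>R _"] cong: if_cong\<close>)
    then have "N = {}"
      by (auto simp: N_def)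
    then show False
      using cardN k by simp
  qed
  define w where "w = (\<lambda>x. if x = v then 1 else - p x)"
  have NC: "N \<subseteq> C" and S: "insert v N \<union> (C - N) = insert v C"
    by (auto simp: N_def)
  have wv: "w v = 1"
    by (simp add: w_def)
  have wC: "w x = - p x" if "x \<in> C" for x
    using that vC by (auto simp: w_def)
  have card: "card (insert v N) = k + 1" "card (C - N) = DIM('a) + 1 - k"
    using vC NC cardN C(2) fin by (auto simp: card_Diff_subset finite_subset card_insert_if)
  have "signed_circuit (insert v N) (C - N) w"
  proof
    show "w \<in> null_space (insert v N \<union> (C - N)) (\<lambda>x. x)"
      unfolding S using fin vC p(1) by (simp add: null_space_def wC wv sum_negf p(2)[symmetric])
    fix u assume "u \<in> null_space (insert v N \<union> (C - N)) (\<lambda>x. x)"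
    then have u: "u v + sum u C = 0" "u v *\<^sub>R v + (\<Sum>x\<in>C. u x *\<^sub>R x) = 0"
      unfolding S using fin vC by (auto simp: null_space_def)
    have "u c = - u v * p c" if "c \<in> C" for c
    proof (rule barycentric_coordinates_unique[OF C(1) _ _ that])
      show "sum u C = (\<Sum>c\<in>C. - u v * p c)"
        using u(1) p(1) by (simp add: sum_distrib_left[symmetric] sum_negf)
      have "(\<Sum>x\<in>C. (- u v * p x) *\<^sub>R x) = - (u v *\<^sub>R v)"
        by (simp add: p(2) scaleR_sum_right sum_negf)
      moreover have "(\<Sum>x\<in>C. u x *\<^sub>R x) = - (u v *\<^sub>R v)"
        using u(2) by (simp add: eq_neg_iff_add_eq_0 add.commute)
      ultimately show "(\<Sum>x\<in>C. u x *\<^sub>R x) = (\<Sum>x\<in>C. (- u v * p x) *\<^sub>R x)"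
        by (simp only:)
    qed
    then show "\<exists>r. \<forall>x\<in>insert v N \<union> (C - N). u x = r * w x"
      unfolding S by (intro exI[of _ "u v"]) (auto simp: wC wv)
  next
    show "0 < w x" if "x \<in> insert v N" for x
      using that by (auto simp: w_def N_def)
    show "w x < 0" if "x \<in> C - N" for x
      using that rest[of x] wC[of x] by auto
    show "finite (insert v N)" "finite (C - N)" "insert v N \<inter> (C - N) = {}"
      using fin NC vC by (auto intro: finite_subset)
    show "2 \<le> card (insert v N)" "2 \<le> card (C - N)"
      using card k by auto
  qed
  moreover have "convex hull (insert v \<Delta>) = convex hull (insert v N \<union> (C - N))"
    unfolding S C(3) by (rule hull_insert[symmetric])
  ultimately show thesis
    using that card by blast
qed

lemma T_data_exists:
  assumes "1 \<le> k" "k \<le> DIM('a::euclidean_space)"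
  obtains \<Delta> :: "'a::euclidean_space set" and v where "T_data k \<Delta> v" "v \<notin> \<Delta>"
proof -
  obtain C :: "'a set" where C: "\<not> affine_dependent C" "affine hull C = UNIV"
    using affine_basis_exists[of "UNIV :: 'a set"] by auto
  have fin: "finite C"
    using C(1) by (rule aff_independent_finite)
  have cardC: "card C = DIM('a) + 1"
    using aff_dim_affine_independent[OF C(1)] C(2) aff_dim_affine_hull[of C] by simp
  obtain N where N: "N \<subseteq> C" "card N = k"
    using obtain_subset_with_card_n[of k C] assms cardC by auto
  have finN: "finite N"
    using N fin finite_subset by blast
  \<comment> \<open>The value \<open>t\<close> makes the coordinates \<open>-1\<close> (\<open>k\<close> times) and \<open>t\<close> (on all other vertices) add up to 1.\<close>
  define t where "t = (1 + real k) / (real DIM('a) + 1 - real k)"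
  define p where "p = (\<lambda>c. if c \<in> N then - 1 else t)"
  define v where "v = (\<Sum>x\<in>C. p x *\<^sub>R x)"
  have t: "t > 0"
    using assms by (simp add: t_def)
  have p1: "sum p C = 1"
  proof -
    have "sum p C = sum p (C - N) + sum p N"
      using sum.subset_diff[OF N(1) fin] .
    also have "\<dots> = real (card (C - N)) * t - real k"
      using N by (simp add: p_def)
    also have "real (card (C - N)) = real DIM('a) + 1 - real k"
      using N finN cardC assms by (simp add: card_Diff_subset)
    finally show ?thesis
      using assms by (simp add: t_def)
  qed
  have neg: "p c < 0 \<longleftrightarrow> c \<in> N" for c
    using t by (auto simp: p_def)
  have "T_data k (convex hull C) v"
    unfolding T_data_def
  proof (intro conjI allI impI)
    show "int DIM('a) simplex convex hull C"
      using C cardC by (auto simp: simplex_def)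
    show "card {F. F facet_of convex hull C \<and> beyond v F (convex hull C)} = k"
      using card_facets_beyond[OF C(1) cardC p1] N by (simp add: v_def neg Int_absorb1 Collect_conj_eq)
    fix F assume F: "F facet_of convex hull C \<and> \<not> beyond v F (convex hull C)"
    then obtain c where c: "c \<in> C" "F = convex hull (C - {c})"
      using C by (auto simp: facet_of_convex_hull_affine_independent_alt)
    then have "0 < p c"
      using F simplex_facet_sides(1)[OF C(1) cardC c(1) p1] t by (auto simp: v_def p_def split: if_splits)
    then show "beneath v F (convex hull C)"
      using simplex_facet_sides(2)[OF C(1) cardC c(1) p1] c by (simp add: v_def)
  qed
  moreover have "v \<notin> convex hull C"
  proof
    assume "v \<in> convex hull C"
    then obtain q where q: "\<forall>x\<in>C. 0 \<le> q x" "sum q C = 1" "(\<Sum>x\<in>C. q x *\<^sub>R x) = v"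
      using convex_hull_finite[OF fin] by auto
    obtain c where "c \<in> N"
      using N assms by fastforce
    then have "p c = q c"
      using barycentric_coordinates_unique[OF C(1), of p q c] N(1) p1 q(2,3) by (auto simp: v_def)
    then show False
      using q(1) neg[of c] \<open>c \<in> N\<close> N(1) by (metis not_le subsetD)
  qed
  ultimately show thesis
    using that by blast
qed

section \<open>Simple 3-polytopes\<close>

lemma card_filter_of_bool: "finite F \<Longrightarrow> card {k \<in> F. R k} = (\<Sum>k\<in>F. of_bool (R k))"
  by (simp add: of_bool_def sum.If_cases Int_def)

text \<open>
  A functional that identifies two given distinct points lies in a hyperplane, and finitely many
  hyperplanes do not cover the space.
\<close>
lemma exists_injective_functional:
  fixes X :: "'a::euclidean_space set"
  assumes "finite X"
  obtains a where "inj_on (\<lambda>x. a \<bullet> x) X"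
proof -
  define D where "D = (\<lambda>(x, y). x - y) ` {(x, y). x \<in> X \<and> y \<in> X \<and> x \<noteq> y}"
  have "finite D"
    unfolding D_def
    by (rule finite_imageI, rule finite_subset[of _ "X \<times> X"]) (use assms in auto)
  moreover have "negligible {a. d \<bullet> a = 0}" if "d \<in> D" for d
    using that by (intro negligible_hyperplane) (auto simp: D_def)
  ultimately have "negligible (\<Union>d\<in>D. {a. d \<bullet> a = 0})"
    by (intro negligible_Union) auto
  then have "(\<Union>d\<in>D. {a. d \<bullet> a = 0}) \<noteq> UNIV"
    using non_negligible_UNIV by metis
  then obtain a where a: "\<And>d. d \<in> D \<Longrightarrow> d \<bullet> a \<noteq> 0"
    by auto
  have "inj_on (\<lambda>x. a \<bullet> x) X"
  proof (rule inj_onI, rule ccontr)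
    fix x y assume "x \<in> X" "y \<in> X" "a \<bullet> x = a \<bullet> y" "x \<noteq> y"
    moreover from this have "x - y \<in> D"
      by (auto simp: D_def intro!: image_eqI[of _ _ "(x, y)"])
    ultimately show False
      using a[of "x - y"] by (simp add: inner_commute[of _ a] inner_diff_right)
  qed
  then show thesis
    by (rule that)
qed

lemma card_minimizers:
  assumes "finite Y" "Y \<noteq> {}" "inj_on h Y"
  shows "card {v \<in> Y. \<forall>x\<in>Y. h v \<le> (h x :: real)} = 1"
proof -
  obtain v where v: "v \<in> Y" "\<And>x. x \<in> Y \<Longrightarrow> h v \<le> h x"
    using arg_min_if_finite[OF assms(1,2), of h] by (metis not_le)
  have "{v \<in> Y. \<forall>x\<in>Y. h v \<le> h x} = {v}"
    using v assms(3) by (auto intro: inj_onD[OF assms(3)] antisym)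
  then show ?thesis
    by simp
qed

text \<open>
  Three edges leave a vertex, one opposite to each of its three faces, and \<open>Q\<close> tells which of them go
  up. The faces in which the vertex is lowest or highest are those whose two edges both go up or both
  go down. If the three edges disagree, exactly one pair of them agrees; otherwise all three pairs do.
\<close>
lemma card_agreeing_pairs:
  assumes "card F = 3"
  shows "card {k \<in> F. \<forall>l\<in>F - {k}. Q l} + card {k \<in> F. \<forall>l\<in>F - {k}. \<not> Q l}
    = 1 + 2 * of_bool (\<forall>l\<in>F. Q l) + 2 * of_bool (\<forall>l\<in>F. \<not> Q l)"
proof -
  obtain f g h where F: "F = {f, g, h}" "f \<noteq> g" "f \<noteq> h" "g \<noteq> h"
    using assms by (auto simp: card_3_iff)
  have pairs: "(\<forall>l\<in>F - {f}. R l) \<longleftrightarrow> R g \<and> R h" "(\<forall>l\<in>F - {g}. R l) \<longleftrightarrow> R f \<and> R h"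
    "(\<forall>l\<in>F - {h}. R l) \<longleftrightarrow> R f \<and> R g" for R
    using F by auto
  have count: "card {k \<in> F. R k} = of_bool (R f) + of_bool (R g) + of_bool (R h)" for R
    using F by (subst card_filter_of_bool) auto
  have "card {k \<in> F. \<forall>l\<in>F - {k}. R l}
      = of_bool (R g \<and> R h) + of_bool (R f \<and> R h) + of_bool (R f \<and> R g)" for R
    using count[of "\<lambda>k. \<forall>l\<in>F - {k}. R l"] unfolding pairs .
  moreover have "(\<forall>l\<in>F. R l) \<longleftrightarrow> R f \<and> R g \<and> R h" for R
    using F(1) by simp
  ultimately show ?thesis
    by (cases "Q f"; cases "Q g"; cases "Q h") simp_all
qed

locale simple_three_polytope =
  fixes P :: "'a::euclidean_space set"
  assumes simple: "simple_3_polytope P"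
begin

abbreviation "X \<equiv> vertices_of P"

definition facets_at :: "'a \<Rightarrow> 'a set set" where
  "facets_at v = {f \<in> faces2 P. v \<in> f}"

lemma poly: "polytope P" and dim3: "aff_dim P = 3"
  using simple by (auto simp: simple_3_polytope_def)

lemma faces2_eq_facets: "f \<in> faces2 P \<longleftrightarrow> f facet_of P"
  using dim3 by (auto simp: faces2_def facet_of_def)

lemma finite_faces2: "finite (faces2 P)"
  unfolding faces2_def by (rule finite_subset[OF _ finite_polytope_faces[OF poly]]) auto

lemma finite_X: "finite X"
  using poly by (intro finite_polyhedron_extreme_points polytope_imp_polyhedron)

lemma X_in_P: "v \<in> X \<Longrightarrow> v \<in> P"
  by (auto simp: extreme_point_of_def)

lemma finite_facets_at: "finite (facets_at v)"
  using finite_faces2 by (simp add: facets_at_def)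

lemma card_facets_at: "v \<in> X \<Longrightarrow> card (facets_at v) = 3"
  using simple by (simp add: simple_3_polytope_def facets_at_def)

lemma face_convex_hull_vertices:
  assumes "f face_of P"
  shows "f = convex hull (X \<inter> f)"
proof -
  have "compact f" "convex f"
    using assms poly face_of_polytope_polytope polytope_imp_compact polytope_imp_convex by blast+
  moreover have "{x. x extreme_point_of f} = X \<inter> f"
    using extreme_point_of_face[OF assms] by auto
  ultimately show ?thesis
    using Krein_Milman_Minkowski[of f] by simp
qed

lemma face_has_vertex:
  assumes "f face_of P" "f \<noteq> {}"
  shows "X \<inter> f \<noteq> {}"
  using face_convex_hull_vertices[OF assms(1)] assms(2) by auto

lemma Inter_facets_at:
  assumes "v \<in> X"
  shows "\<Inter>(facets_at v) = {v}"
proof -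
  have "{v} face_of P" "{v} \<noteq> P"
    using assms dim3 by (auto simp: face_of_singleton)
  then have "{v} = \<Inter>{F. F facet_of P \<and> {v} \<subseteq> F}"
    by (intro face_of_polyhedron polytope_imp_polyhedron poly) auto
  also have "{F. F facet_of P \<and> {v} \<subseteq> F} = facets_at v"
    by (auto simp: facets_at_def faces2_eq_facets)
  finally show ?thesis
    by simp
qed

text \<open>
  In the polygon \<open>g\<close> the vertex \<open>v\<close> is the intersection of the edges through it, and each of these edges
  is an intersection of faces at \<open>v\<close>. If \<open>g \<inter> h\<close> is not an edge, the intersection with the third face is
  the only edge of \<open>g\<close> that can pass through \<open>v\<close>, and a single edge does not intersect in a point.
\<close>
lemma facets_meet_in_edge:
  assumes v: "v \<in> X" and g: "g \<in> facets_at v" and h: "h \<in> facets_at v" and "g \<noteq> h"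
  shows "aff_dim (g \<inter> h) = 1"
proof (rule ccontr)
  assume no_edge: "aff_dim (g \<inter> h) \<noteq> 1"
  have gface: "g face_of P" "aff_dim g = 2" and hface: "h face_of P" "aff_dim h = 2"
    using g h by (auto simp: facets_at_def faces2_def)
  have gpoly: "polytope g"
    using poly gface face_of_polytope_polytope by blast
  have "g \<inter> h \<noteq> g"
  proof
    assume "g \<inter> h = g"
    then have "g face_of h"
      using face_of_subset[OF gface(1), of h] face_of_imp_subset[OF hface(1)] by auto
    then show False
      using face_of_aff_dim_lt[of h g] hface gface \<open>g \<noteq> h\<close> face_of_imp_convex by fastforce
  qed
  then have "aff_dim (g \<inter> h) < 2"
    using face_of_aff_dim_lt[of g "g \<inter> h"] gface hface
    by (metis face_of_Int face_of_face face_of_imp_convex inf_le1)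
  then have small: "aff_dim (g \<inter> h) < 1"
    using no_edge by simp
  obtain k where k: "facets_at v = {g, h, k}"
  proof -
    have "card (facets_at v - {g, h}) = 1"
      using g h \<open>g \<noteq> h\<close> card_facets_at[OF v] finite_facets_at by (simp add: card_Diff_subset)
    then obtain k where "facets_at v - {g, h} = {k}"
      by (auto simp: card_1_singleton_iff)
    then show thesis
      using that[of k] g h by blast
  qed
  define E where "E = {e. e facet_of g \<and> {v} \<subseteq> e}"
  have "{v} face_of g" "{v} \<noteq> g"
    using v g gface by (auto simp: face_of_singleton extreme_point_of_face facets_at_def)
  then have E: "{v} = \<Inter>E"
    unfolding E_def by (intro face_of_polyhedron polytope_imp_polyhedron gpoly) auto
  have edge: "e = g \<inter> k \<and> aff_dim e = 1" if e: "e \<in> E" for e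
  proof -
    have e1: "aff_dim e = 1" "e face_of g" "v \<in> e" "e \<subseteq> g"
      using e gface by (auto simp: E_def facet_of_def face_of_imp_subset)
    have eP: "e face_of P" "e \<noteq> P"
      using e1 gface dim3 face_of_trans by auto
    then have eI: "e = \<Inter>{f. f facet_of P \<and> e \<subseteq> f}"
      using e1 by (intro face_of_polyhedron polytope_imp_polyhedron poly) auto
    have sub: "{f. f facet_of P \<and> e \<subseteq> f} \<subseteq> {g, h, k}"
      using k e1(3) by (auto simp: facets_at_def faces2_eq_facets)
    have "\<not> e \<subseteq> h"
      using aff_dim_subset[of e "g \<inter> h"] e1 small by auto
    then have sub2: "{f. f facet_of P \<and> e \<subseteq> f} \<subseteq> {g, k}"
      using sub by auto
    moreover have "g \<in> {f. f facet_of P \<and> e \<subseteq> f}"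
      using g e1(4) by (auto simp: facets_at_def faces2_eq_facets)
    moreover have "{f. f facet_of P \<and> e \<subseteq> f} \<noteq> {g}"
      using eI e1 gface by auto
    ultimately have "{f. f facet_of P \<and> e \<subseteq> f} = {g, k}"
      by blast
    then show ?thesis
      using eI e1 by auto
  qed
  have "E \<noteq> {}"
  proof
    assume "E = {}"
    then have "{v} = (UNIV :: 'a set)"
      using E by simp
    then have "g \<subseteq> {v}"
      by auto
    then show False
      using aff_dim_subset[of g "{v}"] gface by simp
  qed
  then obtain e where "e \<in> E"
    by auto
  then have "E = {e}"
    using edge by blast
  then show False
    using E edge[OF \<open>e \<in> E\<close>] by (metis aff_dim_sing cInf_singleton zero_neq_one)
qed

lemma facets_share_edge:
  assumes "v \<in> X" "g \<in> facets_at v" "h \<in> facets_at v" "g \<noteq> h"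
  shows "(g \<inter> h) edge_of P"
  using facets_meet_in_edge[OF assms] assms
  by (auto simp: edge_of_def facets_at_def faces2_def face_of_Int)

lemma edge_other_end:
  assumes v: "v \<in> X" and e: "e face_of P" "aff_dim e = 1" "v \<in> e"
  obtains w where "w \<in> X" "w \<in> e" "w \<noteq> v"
proof -
  have "polytope e"
    using e poly face_of_polytope_polytope by blast
  then obtain a b where ab: "e = closed_segment a b"
    using e compact_convex_collinear_segment[of e]
    by (metis collinear_aff_dim empty_iff order_refl polytope_imp_compact polytope_imp_convex)
  have "a \<noteq> b"
    using ab e(2) by auto
  have ends: "x \<in> X \<and> x \<in> e \<longleftrightarrow> x = a \<or> x = b" for x
    using extreme_point_of_face[OF e(1), of x] extreme_point_of_segment[of x a b] ab by auto
  show thesis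
    using that ends \<open>a \<noteq> b\<close> v e(3) by metis
qed

text \<open>
  The faces at \<open>v\<close> other than \<open>f\<close> meet in an edge, of which this is the other end.
\<close>
definition neighbour :: "'a \<Rightarrow> 'a set \<Rightarrow> 'a" where
  "neighbour v f = (SOME w. w \<in> X \<and> w \<notin> f \<and> (\<forall>g\<in>facets_at v - {f}. w \<in> g))"

lemma neighbour:
  assumes v: "v \<in> X" and f: "f \<in> facets_at v"
  shows "neighbour v f \<in> X" "neighbour v f \<notin> f"
    "\<And>g. g \<in> facets_at v \<Longrightarrow> g \<noteq> f \<Longrightarrow> neighbour v f \<in> g"
proof -
  have "card (facets_at v - {f}) = 2"
    using card_facets_at[OF v] f finite_facets_at by simp
  then obtain g h where gh: "facets_at v - {f} = {g, h}" "g \<noteq> h"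
    by (auto simp: card_2_iff)
  then have mem: "g \<in> facets_at v" "h \<in> facets_at v"
    by auto
  then have "(g \<inter> h) face_of P" "aff_dim (g \<inter> h) = 1" "v \<in> g \<inter> h"
    using facets_share_edge[OF v mem gh(2)] by (auto simp: edge_of_def facets_at_def)
  then obtain w where w: "w \<in> X" "w \<in> g \<inter> h" "w \<noteq> v"
    using edge_other_end[OF v] by metis
  have "w \<notin> f"
  proof
    assume "w \<in> f"
    then have "w \<in> \<Inter>(facets_at v)"
      using w gh by blast
    then show False
      using Inter_facets_at[OF v] w by simp
  qed
  then have "\<exists>w. w \<in> X \<and> w \<notin> f \<and> (\<forall>g\<in>facets_at v - {f}. w \<in> g)"
    using w gh by auto
  then have "neighbour v f \<in> X \<and> neighbour v f \<notin> f \<and> (\<forall>g\<in>facets_at v - {f}. neighbour v f \<in> g)"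
    unfolding neighbour_def by (rule someI_ex)
  then show "neighbour v f \<in> X" "neighbour v f \<notin> f"
    "\<And>g. g \<in> facets_at v \<Longrightarrow> g \<noteq> f \<Longrightarrow> neighbour v f \<in> g"
    by auto
qed

text \<open>
  The normals \<open>a f\<close> of the three faces are, up to negative factors, dual to the directions \<open>u f\<close> of the
  three edges. Hence these directions are independent and, the polytope being of dimension 3, span.
  The coordinate of \<open>x - v\<close> along \<open>u f\<close> is a positive multiple of the slack of \<open>x\<close> in the
  inequality of \<open>f\<close>, which makes it nonnegative, and zero on \<open>f\<close>.
\<close>
lemma vertex_cone:
  assumes v: "v \<in> X" and x: "x \<in> P"
  obtains t where "\<And>f. f \<in> facets_at v \<Longrightarrow> 0 \<le> t f"
    "\<And>f. f \<in> facets_at v \<Longrightarrow> x \<in> f \<Longrightarrow> t f = 0"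
    "x - v = (\<Sum>f\<in>facets_at v. t f *\<^sub>R (neighbour v f - v))"
proof -
  let ?F = "facets_at v"
  define u where "u f = neighbour v f - v" for f
  have "\<exists>a. \<exists>b. P \<subseteq> {y. a \<bullet> y \<le> b} \<and> f = P \<inter> {y. a \<bullet> y = b}" if "f \<in> ?F" for f
  proof -
    have "f facet_of P"
      using that by (simp add: facets_at_def faces2_eq_facets)
    from facet_of_polyhedron[OF polytope_imp_polyhedron[OF poly] this] show ?thesis
      by blast
  qed
  then have "\<forall>f\<in>?F. \<exists>a. \<exists>b. P \<subseteq> {y. a \<bullet> y \<le> b} \<and> f = P \<inter> {y. a \<bullet> y = b}"
    by blast
  from bchoice[OF this] obtain a
    where "\<forall>f\<in>?F. \<exists>b. P \<subseteq> {y. a f \<bullet> y \<le> b} \<and> f = P \<inter> {y. a f \<bullet> y = b}" ..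
  from bchoice[OF this] obtain b
    where ab: "\<And>f. f \<in> ?F \<Longrightarrow> P \<subseteq> {y. a f \<bullet> y \<le> b f} \<and> f = P \<inter> {y. a f \<bullet> y = b f}"
    by blast
  have av: "a f \<bullet> v = b f" if "f \<in> ?F" for f
    using that ab[OF that] by (auto simp: facets_at_def)
  have diag: "a f \<bullet> u f < 0" if f: "f \<in> ?F" for f
  proof -
    have "a f \<bullet> neighbour v f \<le> b f" "a f \<bullet> neighbour v f \<noteq> b f"
      using ab[OF f] neighbour(1,2)[OF v f] X_in_P by auto
    then show ?thesis
      using av[OF f] by (simp add: u_def inner_diff_right)
  qed
  have off: "a f \<bullet> u g = 0" if f: "f \<in> ?F" and g: "g \<in> ?F" and "g \<noteq> f" for f g
    using neighbour(3)[OF v g f] ab[OF f] av[OF f] that by (auto simp: u_def inner_diff_right)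
  have dual: "a f \<bullet> (\<Sum>g\<in>?F. s g *\<^sub>R u g) = s f * (a f \<bullet> u f)" if f: "f \<in> ?F" for f s
  proof -
    have "a f \<bullet> (\<Sum>g\<in>?F. s g *\<^sub>R u g) = (\<Sum>g\<in>?F. s g * (a f \<bullet> u g))"
      by (simp add: inner_sum_right)
    also have "\<dots> = (\<Sum>g\<in>?F. if g = f then s f * (a f \<bullet> u f) else 0)"
      using off[OF f] by (intro sum.cong) auto
    finally show ?thesis
      using f finite_facets_at by simp
  qed
  have inj: "inj_on u ?F"
  proof (rule inj_onI, rule ccontr)
    fix f g assume "f \<in> ?F" "g \<in> ?F" "u f = u g" "f \<noteq> g"
    then show False
      using diag[of f] off[of f g] by simp
  qed
  have ind: "independent (u ` ?F)"
  proof (rule independent_if_scalars_zero)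
    show "finite (u ` ?F)"
      using finite_facets_at by simp
    fix s y assume s: "(\<Sum>y\<in>u ` ?F. s y *\<^sub>R y) = 0" and y: "y \<in> u ` ?F"
    obtain f where f: "f \<in> ?F" "y = u f"
      using y by auto
    have "(\<Sum>g\<in>?F. s (u g) *\<^sub>R u g) = 0"
      using s by (simp add: sum.reindex[OF inj])
    then have "s (u f) * (a f \<bullet> u f) = 0"
      using dual[OF f(1), of "\<lambda>g. s (u g)"] by simp
    then show "s y = 0"
      using diag[OF f(1)] f(2) by simp
  qed
  let ?D = "(+) (- v) ` P"
  have "dim ?D = 3"
    using aff_dim_eq_dim[of v P] dim3 X_in_P[OF v] by (simp add: hull_inc)
  moreover have "u ` ?F \<subseteq> ?D"
    using neighbour(1)[OF v] X_in_P by (auto simp: u_def)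
  moreover have "card (u ` ?F) = 3"
    using card_image[OF inj] card_facets_at[OF v] by simp
  ultimately have "?D \<subseteq> span (u ` ?F)"
    using ind by (intro card_ge_dim_independent) auto
  then have "x - v \<in> span (u ` ?F)"
    using x by (auto simp: algebra_simps)
  then obtain s where "(\<Sum>y\<in>u ` ?F. s y *\<^sub>R y) = x - v"
    using finite_facets_at by (auto simp: span_finite)
  then have t: "x - v = (\<Sum>f\<in>?F. s (u f) *\<^sub>R u f)"
    by (simp add: sum.reindex[OF inj])
  have coord: "a f \<bullet> x - b f = s (u f) * (a f \<bullet> u f)" if f: "f \<in> ?F" for f
    using dual[OF f, of "\<lambda>f. s (u f)"] t av[OF f] by (metis inner_diff_right)
  show thesis
  proof
    show "0 \<le> s (u f)" if f: "f \<in> ?F" for f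
    proof -
      have "s (u f) * (a f \<bullet> u f) \<le> 0"
        using coord[OF f] ab[OF f] x by auto
      then show ?thesis
        using diag[OF f] by (simp add: mult_le_0_iff)
    qed
    show "s (u f) = 0" if f: "f \<in> ?F" and "x \<in> f" for f
    proof -
      have "a f \<bullet> x = b f"
        using ab[OF f] that by auto
      then show ?thesis
        using coord[OF f] diag[OF f] by simp
    qed
    show "x - v = (\<Sum>f\<in>?F. s (u f) *\<^sub>R (neighbour v f - v))"
      using t by (simp add: u_def)
  qed
qed

text \<open>
  In the edge cone at \<open>v\<close> the edges that leave a face containing \<open>x\<close> have coefficient 0 in \<open>x - v\<close>,
  so only the other edges must not go down. Points of a fixed face and points of the whole polytope are
  thereby treated alike.
\<close>
lemma minimal_if_below_neighbours:
  assumes v: "v \<in> X" and x: "x \<in> P"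
    and nb: "\<And>g. g \<in> facets_at v \<Longrightarrow> x \<notin> g \<Longrightarrow> a \<bullet> v \<le> a \<bullet> neighbour v g"
  shows "a \<bullet> v \<le> a \<bullet> x"
proof -
  obtain t where t: "\<And>f. f \<in> facets_at v \<Longrightarrow> 0 \<le> t f"
    "\<And>f. f \<in> facets_at v \<Longrightarrow> x \<in> f \<Longrightarrow> t f = 0"
    "x - v = (\<Sum>f\<in>facets_at v. t f *\<^sub>R (neighbour v f - v))"
    using vertex_cone[OF v x] by metis
  have "a \<bullet> (x - v) = (\<Sum>f\<in>facets_at v. t f * (a \<bullet> neighbour v f - a \<bullet> v))"
    by (simp add: t(3) inner_sum_right inner_diff_right)
  also have "\<dots> \<ge> 0"
  proof (rule sum_nonneg)
    fix f assume "f \<in> facets_at v"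
    then show "0 \<le> t f * (a \<bullet> neighbour v f - a \<bullet> v)"
      using t(1,2)[of f] nb[of f] by (cases "x \<in> f") auto
  qed
  finally show ?thesis
    by (simp add: inner_diff_right)
qed

lemma minimal_in_facet_iff:
  assumes v: "v \<in> X" and f: "f \<in> facets_at v" and inj: "inj_on (\<lambda>x. a \<bullet> x) X"
  shows "(\<forall>x\<in>X \<inter> f. a \<bullet> v \<le> a \<bullet> x) \<longleftrightarrow> (\<forall>g\<in>facets_at v - {f}. a \<bullet> v < a \<bullet> neighbour v g)"
proof
  assume min: "\<forall>x\<in>X \<inter> f. a \<bullet> v \<le> a \<bullet> x"
  show "\<forall>g\<in>facets_at v - {f}. a \<bullet> v < a \<bullet> neighbour v g"
  proof
    fix g assume g: "g \<in> facets_at v - {f}"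
    then have "neighbour v g \<in> X \<inter> f" "neighbour v g \<noteq> v"
      using neighbour[OF v, of g] f by (auto simp: facets_at_def)
    then show "a \<bullet> v < a \<bullet> neighbour v g"
      using min inj v by (metis IntD1 inj_onD order_le_less)
  qed
next
  assume nb: "\<forall>g\<in>facets_at v - {f}. a \<bullet> v < a \<bullet> neighbour v g"
  show "\<forall>x\<in>X \<inter> f. a \<bullet> v \<le> a \<bullet> x"
  proof
    fix x assume "x \<in> X \<inter> f"
    then show "a \<bullet> v \<le> a \<bullet> x"
      using nb X_in_P by - (rule minimal_if_below_neighbours[OF v], auto intro: less_imp_le)
  qed
qed

lemma minimal_iff:
  assumes v: "v \<in> X" and inj: "inj_on (\<lambda>x. a \<bullet> x) X"
  shows "(\<forall>x\<in>X. a \<bullet> v \<le> a \<bullet> x) \<longleftrightarrow> (\<forall>g\<in>facets_at v. a \<bullet> v < a \<bullet> neighbour v g)"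
proof
  assume min: "\<forall>x\<in>X. a \<bullet> v \<le> a \<bullet> x"
  show "\<forall>g\<in>facets_at v. a \<bullet> v < a \<bullet> neighbour v g"
  proof
    fix g assume g: "g \<in> facets_at v"
    then have "neighbour v g \<in> X" "neighbour v g \<noteq> v"
      using neighbour[OF v, of g] by (auto simp: facets_at_def)
    then show "a \<bullet> v < a \<bullet> neighbour v g"
      using min inj v by (metis inj_onD order_le_less)
  qed
next
  assume "\<forall>g\<in>facets_at v. a \<bullet> v < a \<bullet> neighbour v g"
  then have nb: "a \<bullet> v \<le> a \<bullet> neighbour v g" if "g \<in> facets_at v" for g
    using that less_imp_le by blast
  show "\<forall>x\<in>X. a \<bullet> v \<le> a \<bullet> x"
  proof
    fix x assume "x \<in> X"
    then show "a \<bullet> v \<le> a \<bullet> x"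
      by (rule minimal_if_below_neighbours[OF v X_in_P nb])
  qed
qed

text \<open>
  Each face has exactly one lowest vertex.
\<close>
lemma sum_facets_minimized:
  assumes inj: "inj_on (\<lambda>x. a \<bullet> x) X"
  shows "(\<Sum>v\<in>X. card {f \<in> facets_at v. \<forall>x\<in>X \<inter> f. a \<bullet> v \<le> a \<bullet> x}) = card (faces2 P)"
proof -
  have "card {v \<in> X. v \<in> f \<and> (\<forall>x\<in>X \<inter> f. a \<bullet> v \<le> a \<bullet> x)} = 1" if "f \<in> faces2 P" for f
  proof -
    have "X \<inter> f \<noteq> {}"
      using that by (intro face_has_vertex) (auto simp: faces2_def)
    then have "card {v \<in> X \<inter> f. \<forall>x\<in>X \<inter> f. a \<bullet> v \<le> a \<bullet> x} = 1"
      using finite_X inj by (intro card_minimizers) (auto intro: inj_on_subset)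
    moreover have "{v \<in> X \<inter> f. \<forall>x\<in>X \<inter> f. a \<bullet> v \<le> a \<bullet> x}
        = {v \<in> X. v \<in> f \<and> (\<forall>x\<in>X \<inter> f. a \<bullet> v \<le> a \<bullet> x)}"
      by auto
    ultimately show ?thesis
      by simp
  qed
  then have "(\<Sum>v\<in>X. card {f \<in> faces2 P. v \<in> f \<and> (\<forall>x\<in>X \<inter> f. a \<bullet> v \<le> a \<bullet> x)}) = 1 * card (faces2 P)"
    using finite_X finite_faces2 by (intro sum_multicount) auto
  then show ?thesis
    by (simp add: facets_at_def conj_assoc)
qed

text \<open>
  Each face has one lowest and one highest vertex, so twice the number of faces counts the pairs of a
  vertex and a face in which it is lowest or highest. By \<open>card_agreeing_pairs\<close> a vertex contributes 1,
  except for the lowest and the highest vertex of the polytope, which contribute 3 each.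
\<close>
theorem two_card_faces2: "2 * card (faces2 P) = card X + 4"
proof -
  obtain a where inj: "inj_on (\<lambda>x. a \<bullet> x) X"
    using exists_injective_functional[OF finite_X] .
  have inj': "inj_on (\<lambda>x. (- a) \<bullet> x) X"
    using inj by (auto simp: inj_on_def)
  have ne: "X \<noteq> {}"
  proof -
    have "P face_of P" "P \<noteq> {}"
      using poly dim3 by (auto simp: face_of_refl polytope_imp_convex)
    then show ?thesis
      using face_has_vertex by blast
  qed
  have count: "card {f \<in> facets_at v. \<forall>x\<in>X \<inter> f. a \<bullet> v \<le> a \<bullet> x}
      + card {f \<in> facets_at v. \<forall>x\<in>X \<inter> f. (- a) \<bullet> v \<le> (- a) \<bullet> x}
      = 1 + 2 * of_bool (\<forall>x\<in>X. a \<bullet> v \<le> a \<bullet> x) + 2 * of_bool (\<forall>x\<in>X. (- a) \<bullet> v \<le> (- a) \<bullet> x)"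
    if v: "v \<in> X" for v
  proof -
    define Q where "Q g \<longleftrightarrow> a \<bullet> v < a \<bullet> neighbour v g" for g
    have Q': "(- a) \<bullet> v < (- a) \<bullet> neighbour v g \<longleftrightarrow> \<not> Q g" if g: "g \<in> facets_at v" for g
    proof -
      have "a \<bullet> neighbour v g \<noteq> a \<bullet> v"
        using neighbour(1,2)[OF v g] g v inj by (auto simp: facets_at_def dest!: inj_onD)
      then show ?thesis
        by (auto simp: Q_def)
    qed
    have "{f \<in> facets_at v. \<forall>x\<in>X \<inter> f. a \<bullet> v \<le> a \<bullet> x} = {f \<in> facets_at v. \<forall>g\<in>facets_at v - {f}. Q g}"
      using minimal_in_facet_iff[OF v _ inj] by (auto simp: Q_def)
    moreover have "{f \<in> facets_at v. \<forall>x\<in>X \<inter> f. (- a) \<bullet> v \<le> (- a) \<bullet> x}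
        = {f \<in> facets_at v. \<forall>g\<in>facets_at v - {f}. \<not> Q g}"
      using minimal_in_facet_iff[OF v _ inj'] Q' by (intro Collect_cong conj_cong) auto
    moreover have "(\<forall>x\<in>X. a \<bullet> v \<le> a \<bullet> x) \<longleftrightarrow> (\<forall>g\<in>facets_at v. Q g)"
      using minimal_iff[OF v inj] by (simp add: Q_def)
    moreover have "(\<forall>x\<in>X. (- a) \<bullet> v \<le> (- a) \<bullet> x) \<longleftrightarrow> (\<forall>g\<in>facets_at v. \<not> Q g)"
      using minimal_iff[OF v inj'] Q' by simp
    ultimately show ?thesis
      using card_agreeing_pairs[OF card_facets_at[OF v], of Q] by presburger
  qed
  have "2 * card (faces2 P) = (\<Sum>v\<in>X. card {f \<in> facets_at v. \<forall>x\<in>X \<inter> f. a \<bullet> v \<le> a \<bullet> x})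
      + (\<Sum>v\<in>X. card {f \<in> facets_at v. \<forall>x\<in>X \<inter> f. (- a) \<bullet> v \<le> (- a) \<bullet> x})"
    unfolding sum_facets_minimized[OF inj] sum_facets_minimized[OF inj'] by simp
  also have "\<dots> = (\<Sum>v\<in>X. card {f \<in> facets_at v. \<forall>x\<in>X \<inter> f. a \<bullet> v \<le> a \<bullet> x}
      + card {f \<in> facets_at v. \<forall>x\<in>X \<inter> f. (- a) \<bullet> v \<le> (- a) \<bullet> x})"
    by (rule sum.distrib[symmetric])
  also have "\<dots> = (\<Sum>v\<in>X. 1 + 2 * of_bool (\<forall>x\<in>X. a \<bullet> v \<le> a \<bullet> x)
      + 2 * of_bool (\<forall>x\<in>X. (- a) \<bullet> v \<le> (- a) \<bullet> x))"
    by (rule sum.cong[OF refl count]) simp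
  also have "\<dots> = card X + 2 * card {v \<in> X. \<forall>x\<in>X. a \<bullet> v \<le> a \<bullet> x}
      + 2 * card {v \<in> X. \<forall>x\<in>X. (- a) \<bullet> v \<le> (- a) \<bullet> x}"
    unfolding card_filter_of_bool[OF finite_X] sum.distrib sum_distrib_left[symmetric] by simp
  also have "\<dots> = card X + 4"
    using card_minimizers[OF finite_X ne inj] card_minimizers[OF finite_X ne inj'] by presburger
  finally show ?thesis .
qed

end


section \<open>Dependences constant on colour classes\<close>

locale coloured_three_polytope = simple_three_polytope P
  for P :: "'a::euclidean_space set" +
  fixes c :: "'a set \<Rightarrow> nat"
  assumes colouring: "proper_3_coloring P c"
begin

lemma colours_at:
  assumes "v \<in> X"
  shows "inj_on c (facets_at v)" "c ` facets_at v = {1, 2, 3}"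
proof -
  show inj: "inj_on c (facets_at v)"
    using colouring facets_share_edge[OF assms]
    by (intro inj_onI) (metis (no_types, lifting) facets_at_def mem_Collect_eq proper_3_coloring_def)
  have "c ` facets_at v \<subseteq> {1, 2, 3}"
    using colouring unfolding proper_3_coloring_def facets_at_def by blast
  moreover have "card (c ` facets_at v) = 3"
    using card_image[OF inj] card_facets_at[OF assms] by simp
  ultimately show "c ` facets_at v = {1, 2, 3}"
    by (intro card_subset_eq) auto
qed

text \<open>
  The ends of the edge share the two faces other than \<open>f\<close>. The third faces at the two ends have the
  one colour that is left, and equal coefficients because both triples have sum zero.
\<close>
lemma dependency_constant_along_edge:
  assumes dep: "\<And>v. v \<in> X \<Longrightarrow> (\<Sum>f\<in>facets_at v. \<mu> f) = (0::real)"
    and v: "v \<in> X" and f: "f \<in> facets_at v"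
    and k: "k \<in> facets_at v" and l: "l \<in> facets_at (neighbour v f)" and "c k = c l"
  shows "\<mu> k = \<mu> l"
proof -
  define w where "w = neighbour v f"
  have w: "w \<in> X"
    using neighbour(1)[OF v f] by (simp add: w_def)
  define R where "R = facets_at v - {f}"
  have Fv: "facets_at v = insert f R" "f \<notin> R" "finite R"
    using f finite_facets_at by (auto simp: R_def)
  have "R \<subseteq> facets_at w"
    using neighbour(3)[OF v f] by (auto simp: R_def facets_at_def w_def)
  moreover have "card R = 2"
    using Fv card_facets_at[OF v] by simp
  ultimately have "card (facets_at w - R) = 1"
    using card_facets_at[OF w] Fv(3) by (simp add: card_Diff_subset)
  then obtain f' where "facets_at w - R = {f'}"
    by (auto simp: card_1_singleton_iff)
  then have Fw: "facets_at w = insert f' R" "f' \<notin> R"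
    using \<open>R \<subseteq> facets_at w\<close> by auto
  have "\<mu> f + sum \<mu> R = 0" "\<mu> f' + sum \<mu> R = 0"
    using dep[OF v] dep[OF w] Fv Fw by simp_all
  then have \<mu>: "\<mu> f = \<mu> f'"
    by simp
  have injv: "inj_on c (insert f R)" and injw: "inj_on c (insert f' R)"
    and im: "c ` insert f R = c ` insert f' R"
    using colours_at[OF v] colours_at[OF w] Fv Fw by auto
  have kl: "k \<in> insert f R" "l \<in> insert f' R"
    using k l Fv Fw by (auto simp: w_def)
  show ?thesis
  proof (cases "k \<in> R")
    case True
    then have "k = l"
      using inj_onD[OF injw \<open>c k = c l\<close>] kl by auto
    then show ?thesis
      by simp
  next
    case False
    then have "k = f"
      using kl by simp
    moreover have "l \<notin> R"
      using inj_onD[OF injv \<open>c k = c l\<close>] kl False by auto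
    ultimately show ?thesis
      using kl \<mu> by simp
  qed
qed

text \<open>
  Every vertex other than the lowest one \<open>v0\<close> has a lower neighbour, so descending along edges carries
  the coefficients at any vertex to those at \<open>v0\<close>.
\<close>
lemma dependency_constant_on_colours:
  assumes dep: "\<And>v. v \<in> X \<Longrightarrow> (\<Sum>f\<in>facets_at v. \<mu> f) = (0::real)"
    and fg: "f \<in> faces2 P" "g \<in> faces2 P" "c f = c g"
  shows "\<mu> f = \<mu> g"
proof -
  obtain a where inj: "inj_on (\<lambda>x. a \<bullet> x) X"
    using exists_injective_functional[OF finite_X] .
  have nef: "X \<inter> h \<noteq> {}" if "h \<in> faces2 P" for h
    using that by (intro face_has_vertex) (auto simp: faces2_def)
  then obtain v0 where v0: "v0 \<in> X" "\<And>x. x \<in> X \<Longrightarrow> a \<bullet> v0 \<le> a \<bullet> x"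
    using arg_min_if_finite[OF finite_X, of "\<lambda>x. a \<bullet> x"] fg(1) by (metis Int_empty_left not_le)
  have colour: "\<exists>k\<in>facets_at v. c k = i" if "v \<in> X" "i \<in> {1, 2, 3}" for v i
    using colours_at(2)[OF that(1)] that(2) by (metis imageE)
  have range: "c h \<in> {1, 2, 3}" if "h \<in> faces2 P" for h
    using colouring that unfolding proper_3_coloring_def by blast
  have descend: "\<mu> k = \<mu> l"
    if "v \<in> X" "k \<in> facets_at v" "l \<in> facets_at v0" "c k = c l" for v k l
    using that
  proof (induction "card {x \<in> X. a \<bullet> x < a \<bullet> v}" arbitrary: v k rule: less_induct)
    case less
    show ?case
    proof (cases "v = v0")
      case True
      then have "k = l"
        using colours_at(1)[OF v0(1)] less.prems by (auto dest: inj_onD)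
      then show ?thesis
        by simp
    next
      case False
      have "\<not> (\<forall>x\<in>X. a \<bullet> v \<le> a \<bullet> x)"
        using False v0 inj less.prems(1) by (metis antisym inj_onD)
      then obtain g where g: "g \<in> facets_at v" "\<not> a \<bullet> v < a \<bullet> neighbour v g"
        using minimal_iff[OF less.prems(1) inj] by auto
      define w where "w = neighbour v g"
      have w: "w \<in> X" "w \<noteq> v"
        using neighbour(1,2)[OF less.prems(1) g(1)] g(1) by (auto simp: w_def facets_at_def)
      then have "a \<bullet> w < a \<bullet> v"
        using g(2) inj less.prems(1) by (metis inj_onD linorder_neqE w_def)
      then have "{x \<in> X. a \<bullet> x < a \<bullet> w} \<subset> {x \<in> X. a \<bullet> x < a \<bullet> v}"
        using w(1) by auto
      then have smaller: "card {x \<in> X. a \<bullet> x < a \<bullet> w} < card {x \<in> X. a \<bullet> x < a \<bullet> v}"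
        using finite_X by (intro psubset_card_mono) auto
      obtain k' where k': "k' \<in> facets_at w" "c k' = c k"
        using colour[OF w(1), of "c k"] range less.prems(2) by (auto simp: facets_at_def)
      have "\<mu> k = \<mu> k'"
        using dependency_constant_along_edge[OF dep less.prems(1) g(1) less.prems(2), of k'] k'
        by (simp add: w_def)
      also have "\<dots> = \<mu> l"
        using less.hyps[OF smaller w(1) k'(1) less.prems(3)] k' less.prems(4) by simp
      finally show ?thesis .
    qed
  qed
  obtain l where l: "l \<in> facets_at v0" "c l = c f"
    using colour[OF v0(1) range[OF fg(1)]] by auto
  have "\<mu> h = \<mu> l" if h: "h \<in> faces2 P" "c h = c l" for h
  proof -
    obtain v where "v \<in> X" "v \<in> h"
      using nef[OF h(1)] by auto
    then show ?thesis
      using descend[of v h l] h l by (auto simp: facets_at_def)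
  qed
  then show ?thesis
    using fg l by metis
qed

end

section \<open>Incidence vectors of a coloured polytope\<close>

lemma incidence_vector_nth: "incidence_vector vert f $ i = (if vert i \<in> f then 1 else 0)"
  by (simp add: incidence_vector_def)

context coloured_three_polytope
begin

definition colour_class :: "nat \<Rightarrow> 'a set set" where
  "colour_class i = {f \<in> faces2 P. c f = i}"

lemma colour_range: "f \<in> faces2 P \<Longrightarrow> c f \<in> {1, 2, 3}"
  using colouring unfolding proper_3_coloring_def by blast

lemma finite_class: "finite (colour_class i)"
  using finite_faces2 by (simp add: colour_class_def)

lemma faces2_classes: "faces2 P = colour_class 2 \<union> (colour_class 1 \<union> colour_class 3)"
  using colour_range by (auto simp: colour_class_def)

lemma sum_by_colour:
  "(\<Sum>f\<in>faces2 P. h (c f)) = (\<Sum>i\<in>{1, 2, 3}. real (card (colour_class i)) * h i)"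
proof -
  have "(\<Sum>f\<in>faces2 P. h (c f)) = (\<Sum>i\<in>{1, 2, 3}. \<Sum>f\<in>{f \<in> faces2 P. c f = i}. h (c f))"
    using finite_faces2 colour_range by (intro sum.group[symmetric]) auto
  then show ?thesis
    by (simp add: colour_class_def)
qed

text \<open>
  Each colour occurs exactly once at \<open>v\<close>.
\<close>
lemma sum_at_vertex:
  assumes "v \<in> X"
  shows "(\<Sum>f\<in>facets_at v. h (c f)) = h 1 + h 2 + (h 3 :: real)"
proof -
  have "(\<Sum>f\<in>facets_at v. h (c f)) = sum h (c ` facets_at v)"
    using colours_at(1)[OF assms] by (simp add: sum.reindex)
  then show ?thesis
    using colours_at(2)[OF assms] by simp
qed

text \<open>
  A face is the convex hull of its vertices.
\<close>
lemma inj_incidence_vector: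
  fixes vert :: "'v::finite \<Rightarrow> 'a"
  assumes "bij_betw vert UNIV X"
  shows "inj_on (incidence_vector vert) (faces2 P)"
proof (rule inj_onI)
  fix f g assume fg: "f \<in> faces2 P" "g \<in> faces2 P" "incidence_vector vert f = incidence_vector vert g"
  have "vert i \<in> f \<longleftrightarrow> vert i \<in> g" for i
    using arg_cong[OF fg(3), of "\<lambda>x. x $ i"] by (simp add: incidence_vector_nth split: if_splits)
  moreover have "X = range vert"
    using assms by (simp add: bij_betw_def)
  ultimately have "X \<inter> f = X \<inter> g"
    by auto
  then show "f = g"
    using face_convex_hull_vertices[of f] face_convex_hull_vertices[of g] fg by (simp add: faces2_def)
qed

lemma sum_incidence_vectors_nth:
  "(\<Sum>f\<in>faces2 P. \<mu> f *\<^sub>R incidence_vector vert f) $ i = (\<Sum>f\<in>facets_at (vert i). \<mu> f)"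
proof -
  have "(\<Sum>f\<in>faces2 P. \<mu> f *\<^sub>R incidence_vector vert f) $ i
      = (\<Sum>f\<in>faces2 P. if vert i \<in> f then \<mu> f else 0)"
    by (simp add: sum_component incidence_vector_nth if_distrib cong: if_cong)
  also have "\<dots> = (\<Sum>f\<in>facets_at (vert i). \<mu> f)"
    using finite_faces2 by (simp add: facets_at_def sum.inter_filter)
  finally show ?thesis .
qed

text \<open>
  A dependence has coefficients \<open>t i\<close> that depend only on the colour \<open>i\<close>. The coordinate of a vertex in
  the dependence says \<open>t 1 + t 2 + t 3 = 0\<close>, and the sum of all coefficients weights \<open>t i\<close> by the
  number of faces of colour \<open>i\<close>; the solutions of these two equations are the multiples of \<open>coef\<close>.
\<close>
lemma incidence_vectors_circuit:
  fixes vert :: "'v::finite \<Rightarrow> 'a"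
  assumes vert: "bij_betw vert UNIV X"
    and m: "card (colour_class 1) < card (colour_class 2)" "card (colour_class 2) < card (colour_class 3)" "2 \<le> card (colour_class 1)"
  defines "\<xi> \<equiv> incidence_vector vert"
  obtains w where "signed_circuit (\<xi> ` colour_class 2) (\<xi> ` colour_class 1 \<union> \<xi> ` colour_class 3) w"
proof -
  have inj: "inj_on \<xi> (faces2 P)"
    unfolding \<xi>_def by (rule inj_incidence_vector[OF vert])
  have vertX: "vert i \<in> X" for i
    using vert bij_betwE by blast
  define coef :: "nat \<Rightarrow> real" where "coef = (\<lambda>i. if i = 1 then real (card (colour_class 2)) - card (colour_class 3)
    else if i = 2 then real (card (colour_class 3)) - card (colour_class 1)
    else real (card (colour_class 1)) - card (colour_class 2))"
  have coef: "coef 1 = real (card (colour_class 2)) - card (colour_class 3)"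
    "coef 2 = real (card (colour_class 3)) - card (colour_class 1)"
    "coef 3 = real (card (colour_class 1)) - card (colour_class 2)"
    by (simp_all add: coef_def)
  define w where "w = (\<lambda>x. coef (c (inv_into (faces2 P) \<xi> x)))"
  have w: "w (\<xi> f) = coef (c f)" if "f \<in> faces2 P" for f
    using that inj by (simp add: w_def)
  have S: "\<xi> ` colour_class 2 \<union> (\<xi> ` colour_class 1 \<union> \<xi> ` colour_class 3) = \<xi> ` faces2 P"
    by (subst faces2_classes) auto
  have null: "u \<in> null_space (\<xi> ` faces2 P) (\<lambda>x. x) \<longleftrightarrow>
      (\<Sum>f\<in>faces2 P. u (\<xi> f)) = 0 \<and> (\<forall>i. (\<Sum>f\<in>facets_at (vert i). u (\<xi> f)) = 0)" for u
    unfolding null_space_def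
    by (simp add: sum.reindex[OF inj] vec_eq_iff sum_incidence_vectors_nth[of "\<lambda>f. u (\<xi> f)" vert, folded \<xi>_def]
        del: sum_component)
  have sub: "colour_class i \<subseteq> faces2 P" for i
    by (auto simp: colour_class_def)
  have "signed_circuit (\<xi> ` colour_class 2) (\<xi> ` colour_class 1 \<union> \<xi> ` colour_class 3) w"
  proof
    show "w \<in> null_space (\<xi> ` colour_class 2 \<union> (\<xi> ` colour_class 1 \<union> \<xi> ` colour_class 3)) (\<lambda>x. x)"
      unfolding S null
    proof (intro conjI allI)
      have "(\<Sum>f\<in>faces2 P. w (\<xi> f)) = (\<Sum>f\<in>faces2 P. coef (c f))"
        using w by simp
      then show "(\<Sum>f\<in>faces2 P. w (\<xi> f)) = 0"
        unfolding sum_by_colour by (simp add: coef algebra_simps del: One_nat_def)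
      fix i
      have "(\<Sum>f\<in>facets_at (vert i). w (\<xi> f)) = (\<Sum>f\<in>facets_at (vert i). coef (c f))"
        by (intro sum.cong) (auto simp: facets_at_def w)
      then show "(\<Sum>f\<in>facets_at (vert i). w (\<xi> f)) = 0"
        unfolding sum_at_vertex[OF vertX] by (simp add: coef del: One_nat_def)
    qed
    fix u assume "u \<in> null_space (\<xi> ` colour_class 2 \<union> (\<xi> ` colour_class 1 \<union> \<xi> ` colour_class 3)) (\<lambda>x. x)"
    then have u: "(\<Sum>f\<in>faces2 P. u (\<xi> f)) = 0" "\<And>i. (\<Sum>f\<in>facets_at (vert i). u (\<xi> f)) = 0"
      unfolding S null by auto
    define t where "t i = u (\<xi> (SOME f. f \<in> colour_class i))" for i
    have t: "u (\<xi> f) = t (c f)" if f: "f \<in> faces2 P" for f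
    proof -
      have "f \<in> colour_class (c f)"
        using f by (simp add: colour_class_def)
      then have "(SOME g. g \<in> colour_class (c f)) \<in> colour_class (c f)"
        by (rule someI)
      moreover have "(\<Sum>f\<in>facets_at v. u (\<xi> f)) = 0" if "v \<in> X" for v
        using that vert u(2) by (metis bij_betw_imp_surj_on imageE)
      ultimately show ?thesis
        unfolding t_def by (intro dependency_constant_on_colours[OF _ f]) (auto simp: colour_class_def)
    qed
    have "(\<Sum>f\<in>faces2 P. t (c f)) = 0"
      using u(1) t by simp
    then have 1: "card (colour_class 1) * t 1 + card (colour_class 2) * t 2 + card (colour_class 3) * t 3 = 0"
      unfolding sum_by_colour by simp
    have "(\<Sum>f\<in>facets_at (vert i). t (c f)) = 0" for i
    proof -
      have "(\<Sum>f\<in>facets_at (vert i). t (c f)) = (\<Sum>f\<in>facets_at (vert i). u (\<xi> f))"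
        by (intro sum.cong) (auto simp: facets_at_def t)
      then show ?thesis
        using u(2) by simp
    qed
    then have 2: "t 1 + t 2 + t 3 = 0"
      unfolding sum_at_vertex[OF vertX] by simp
    have pos: "coef 2 > 0"
      using m by (simp add: coef del: One_nat_def)
    have 3: "t 3 = - t 1 - t 2"
      using 2 by simp
    have t1: "t 1 * coef 2 = t 2 * coef 1"
      using 1 unfolding 3 coef by (simp only: algebra_simps)
    then have t3: "t 3 * coef 2 = t 2 * coef 3"
      unfolding 3 coef by (simp only: algebra_simps)
    have ti: "t i = t 2 / coef 2 * coef i" if "i \<in> {1, 2, 3}" for i
      using that t1 t3 pos by (auto simp: field_simps)
    have "u (\<xi> f) = t 2 / coef 2 * w (\<xi> f)" if "f \<in> faces2 P" for f
      using ti[OF colour_range[OF that]] unfolding t[OF that] w[OF that] .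
    then have "\<forall>x\<in>\<xi> ` faces2 P. u x = t 2 / coef 2 * w x"
      by blast
    then show "\<exists>r. \<forall>x\<in>\<xi> ` colour_class 2 \<union> (\<xi> ` colour_class 1 \<union> \<xi> ` colour_class 3). u x = r * w x"
      unfolding S by blast
  next
    have w_class: "w (\<xi> f) = coef i" if "f \<in> colour_class i" for f i
      using that w[of f] by (simp add: colour_class_def)
    have signs: "0 < coef 2" "coef 1 < 0" "coef 3 < 0"
      using m by (simp_all add: coef del: One_nat_def)
    show "0 < w x" if "x \<in> \<xi> ` colour_class 2" for x
      using that w_class signs by force
    show "w x < 0" if "x \<in> \<xi> ` colour_class 1 \<union> \<xi> ` colour_class 3" for x
      using that w_class signs by force
    show "\<xi> ` colour_class 2 \<inter> (\<xi> ` colour_class 1 \<union> \<xi> ` colour_class 3) = {}"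
      using inj by (fastforce simp: colour_class_def dest: inj_onD)
    show "finite (\<xi> ` colour_class 2)" "finite (\<xi> ` colour_class 1 \<union> \<xi> ` colour_class 3)"
      using finite_class by auto
    have card: "card (\<xi> ` colour_class i) = card (colour_class i)" for i
      by (rule card_image[OF inj_on_subset[OF inj sub]])
    show "2 \<le> card (\<xi> ` colour_class 2)"
      using card m by simp
    have "card (\<xi> ` colour_class 1) \<le> card (\<xi> ` colour_class 1 \<union> \<xi> ` colour_class 3)"
      using finite_class by (intro card_mono) auto
    then show "2 \<le> card (\<xi> ` colour_class 1 \<union> \<xi> ` colour_class 3)"
      using card m by simp
  qed
  then show thesis
    by (rule that)
qed

end

theorem proposition4p1:
  fixes P :: "'a::euclidean_space set"
    and c :: "'a set \<Rightarrow> nat"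
    and n :: nat
    and vert :: "'v::finite \<Rightarrow> 'a"
    and m :: "nat \<Rightarrow> nat"
    and V :: "nat \<Rightarrow> (real^'v) set"
    and S :: "(real^'v) set"
    and Pt :: "(real^'v) set"
  assumes "three_colorable P"
    and "proper_3_coloring P c"
    and "card (vertices_of P) = 2 * n"
    and "bij_betw vert UNIV (vertices_of P)"
    and "CARD('n::finite) = n"
    and "\<And>i. m i = card {f \<in> faces2 P. c f = i}"
    and "\<And>i. V i = incidence_vector vert ` {f \<in> faces2 P. c f = i}"
    and "S = incidence_vector vert ` faces2 P"
    and "Pt = convex hull S"
    and "m 3 > m 2" and "m 2 > m 1" and "m 1 \<ge> 2"
  shows
    "(\<exists>d :: real^'v \<Rightarrow> real.
        polytope_gale_diagram Pt d \<and>
        image_mset d (mset_set (vertices_of Pt)) =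
          replicate_mset (m 2) 1 + replicate_mset (m 1 + m 3) (-1) \<and>
        (\<forall>x \<in> V 1 \<union> V 3. d x = -1) \<and>
        (\<forall>x \<in> V 2. d x = 1)) \<and>
     (\<forall>J. J \<subseteq> S \<longrightarrow>
        ((convex hull J) proper_face_of Pt \<longleftrightarrow>
           \<not> V 2 \<subseteq> J \<and> \<not> V 1 \<union> V 3 \<subseteq> J)) \<and>
     simplicial_polytope Pt \<and>
     (\<exists>(\<Delta> :: (real^'n) set) v. T_data (m 2 - 1) \<Delta> v \<and> v \<notin> \<Delta>) \<and>
     (\<forall>(\<Delta> :: (real^'n) set) v. T_data (m 2 - 1) \<Delta> v \<longrightarrow>
        combinatorially_equivalent Pt (convex hull (insert v \<Delta>)))"
proof -
  interpret coloured_three_polytope P c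
    using assms(1,2) by unfold_locales (auto simp: three_colorable_def)
  have m: "m i = card (colour_class i)" and V: "V i = incidence_vector vert ` colour_class i" for i
    using assms(6,7) by (simp_all add: colour_class_def)
  have S: "S = V 2 \<union> (V 1 \<union> V 3)"
    unfolding assms(8) V by (subst faces2_classes) auto
  have inj: "inj_on (incidence_vector vert) (faces2 P)"
    using assms(4) by (rule inj_incidence_vector)
  have cardV: "card (V i) = m i" for i
    unfolding V m using inj by (intro card_image inj_on_subset[OF inj]) (auto simp: colour_class_def)
  obtain w where circuit: "signed_circuit (V 2) (V 1 \<union> V 3) w"
    unfolding V using incidence_vectors_circuit[OF assms(4)] assms(10-12) m by metis
  interpret Q: signed_circuit "V 2" "V 1 \<union> V 3" w
    by (fact circuit)
  have Pt: "Pt = convex hull (V 2 \<union> (V 1 \<union> V 3))"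
    unfolding assms(9) S ..
  have "V 1 \<inter> V 3 = {}"
    unfolding V using inj by (auto simp: colour_class_def dest!: inj_onD)
  then have card13: "card (V 1 \<union> V 3) = m 1 + m 3"
    using Q.finite cardV by (simp add: card_Un_disjoint)
  have "card S = card (faces2 P)"
    unfolding assms(8) using inj by (rule card_image)
  then have "2 * card S = 2 * n + 4"
    using two_card_faces2 assms(3) by simp
  moreover have "card S = m 2 + (m 1 + m 3)"
    unfolding S using Q.finite Q.disjoint cardV card13 by (simp add: card_Un_disjoint)
  ultimately have n: "n + 2 = m 1 + m 2 + m 3"
    by simp
  have dim: "DIM(real^'n) = n"
    using assms(5) by simp
  have k: "1 \<le> m 2 - 1" "m 2 - 1 < DIM(real^'n)"
    using n dim assms(10-12) by simp_all
  have gale: "\<exists>d :: real^'v \<Rightarrow> real.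
        polytope_gale_diagram Pt d \<and>
        image_mset d (mset_set (vertices_of Pt)) =
          replicate_mset (m 2) 1 + replicate_mset (m 1 + m 3) (-1) \<and>
        (\<forall>x \<in> V 1 \<union> V 3. d x = -1) \<and>
        (\<forall>x \<in> V 2. d x = 1)"
  proof (intro exI[of _ "sgn \<circ> w"] conjI)
    show "polytope_gale_diagram Pt (sgn \<circ> w)"
      unfolding Pt by (rule Q.gale_diagram_signs)
    show neg: "\<forall>x \<in> V 1 \<union> V 3. (sgn \<circ> w) x = -1" and pos: "\<forall>x \<in> V 2. (sgn \<circ> w) x = 1"
      using Q.pos Q.neg by auto
    have const: "image_mset (sgn \<circ> w) (mset_set Y) = replicate_mset (card Y) r"
      if "\<forall>x\<in>Y. (sgn \<circ> w) x = r" "finite Y" for Y r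
    proof -
      have "image_mset (sgn \<circ> w) (mset_set Y) = image_mset (\<lambda>_. r) (mset_set Y)"
        using that by (intro image_mset_cong) simp
      then show ?thesis
        by (simp add: image_mset_const_eq)
    qed
    show "image_mset (sgn \<circ> w) (mset_set (vertices_of Pt)) =
          replicate_mset (m 2) 1 + replicate_mset (m 1 + m 3) (-1)"
      unfolding Pt Q.vertices mset_set_Union[OF Q.finite Q.disjoint] image_mset_union
        const[OF pos Q.finite(1)] const[OF neg Q.finite(2)] cardV card13 ..
  qed
  have faces: "\<forall>J. J \<subseteq> S \<longrightarrow>
        ((convex hull J) proper_face_of Pt \<longleftrightarrow>
           \<not> V 2 \<subseteq> J \<and> \<not> V 1 \<union> V 3 \<subseteq> J)"
    unfolding Pt S using Q.proper_face_iff by blast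
  have "simplicial_polytope Pt"
    unfolding Pt by (rule Q.simplicial)
  moreover obtain \<Delta> :: "(real^'n) set" and v where "T_data (m 2 - 1) \<Delta> v" "v \<notin> \<Delta>"
    using T_data_exists[of "m 2 - 1", where 'a = "real^'n"] k by auto
  moreover have "combinatorially_equivalent Pt (convex hull (insert v \<Delta>))"
    if T: "T_data (m 2 - 1) \<Delta> v" for \<Delta> :: "(real^'n) set" and v
  proof -
    obtain A B w' where AB: "signed_circuit A B w'" "card A = m 2 - 1 + 1"
      "card B = DIM(real^'n) + 1 - (m 2 - 1)"
      "convex hull (insert v \<Delta>) = convex hull (A \<union> B)"
      using T_data_signed_circuit[OF T k] by metis
    have "card (V 2) = card A" "card (V 1 \<union> V 3) = card B"
      unfolding AB(2,3) cardV card13 dim using n k by linarith+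
    then show ?thesis
      unfolding Pt AB(4) by (rule signed_circuits_combinatorially_equivalent[OF circuit AB(1)])
  qed
  ultimately show ?thesis
    using gale faces by blast
qed

end
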